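(* Let $(X,\mathbf R)$ be a symmetric association scheme with $D\ge3$ classes which is metric with respect to $A_0,\dots,A_D$ and cometric with respect to $E_0,\dots,E_D$, and which is not an ordinary cycle. Let $Y\subseteq X$ with $1<|Y|<|X|$ and set $\delta=\delta(Y)$. Let $0\le t\le D$ and suppose that $E_k^*(x)\chi_Y$ is a relative $t$-design with respect to $x$ for every $0\le k\le D$ and every $x\in Y$. Suppose further that for every $x\in Y$, each irreducible $T(x)$-module $W\subseteq V$ with $1\le r(W)\le\delta$ satisfies $r^*(W)\le r(W)$. Then one of the following holds: (i) $(X,R_1)$ is bipartite and $Y$ is one of its two bipartite halves (colour classes); (ii) $(X,\mathbf R)$ is an antipodal double cover and $Y=\{x,y\}$ is an antipodal pair, i.e. $(x,y)\in R_D$; (iii) $\delta\ge t+1$.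
   Context: $(X,\mathbf R)$ is a symmetric association scheme with associate matrices $A_0=I,\dots,A_D$, Bose–Mesner algebra $M$, primitive idempotents $E_0=|X|^{-1}J,\dots,E_D$. Metric: $(X,R_1)$ is distance-regular with $R_i$ its distance-$i$ relation. Cometric: each $E_j$ is a polynomial of degree exactly $j$ in $E_1$ under entrywise multiplication. Antipodal double cover: the relation "$y=z$ or $(y,z)\in R_D$" is an equivalence relation on $X$ whose classes all have size $2$. $V=\mathbb C^X$ with standard basis $\{\hat y\}$ and standard Hermitian inner product; $\chi_Y=\sum_{y\in Y}\hat y$. $\delta(Y)=\min\{i\ne0:\langle\chi_Y,A_i\chi_Y\rangle\ne0\}$ (minimum distance). $E_i^*(x)$ diagonal with $(E_i^*(x))_{yy}=(A_i)_{xy}$; $A_i^*(x)$ diagonal with $(A_i^*(x))_{yy}=|X|(E_i)_{xy}$; $T(x)$ generated by $M$ and the $A_i^*(x)$. For an irreducible $T(x)$-module $W$: $r(W)=\min\{i:E_i^*(x)W\ne0\}$, $r^*(W)=\min\{j:E_jW\ne0\}$. $\psi$ is a relative $t$-design with respect to $x$ if $E_j\psi$ and $E_j\hat x$ are linearly dependent for all $1\le j\le t$. *)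

theory Defs
  imports Complex_Main "HOL-Computational_Algebra.Polynomial"
begin

text \<open>The vertex set X is the finite type 'x (X = UNIV); V = 'x \<Rightarrow> complex;
  matrices are functions 'x \<Rightarrow> 'x \<Rightarrow> complex.\<close>

type_synonym 'x cvec = "'x \<Rightarrow> complex"
type_synonym 'x cmat = "'x \<Rightarrow> 'x \<Rightarrow> complex"

definition mmult :: "'x::finite cmat \<Rightarrow> 'x cmat \<Rightarrow> 'x cmat" where
  "mmult A B = (\<lambda>x y. \<Sum>z\<in>UNIV. A x z * B z y)"

definition mvec :: "'x::finite cmat \<Rightarrow> 'x cvec \<Rightarrow> 'x cvec" where
  "mvec A v = (\<lambda>x. \<Sum>y\<in>UNIV. A x y * v y)"

definition zmat :: "'x cmat" where "zmat = (\<lambda>x y. 0)"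
definition zvec :: "'x cvec" where "zvec = (\<lambda>x. 0)"

definition adj :: "('x \<times> 'x) set \<Rightarrow> 'x cmat" where
  "adj S = (\<lambda>x y. if (x, y) \<in> S then 1 else 0)"

definition assoc_scheme :: "nat \<Rightarrow> (nat \<Rightarrow> ('x::finite \<times> 'x) set) \<Rightarrow> bool" where
  "assoc_scheme D R \<longleftrightarrow>
     1 \<le> D \<and>
     (\<forall>i\<le>D. R i \<noteq> {}) \<and>
     R 0 = Id \<and>
     (\<forall>x y. \<exists>!i. i \<le> D \<and> (x, y) \<in> R i) \<and>
     (\<forall>i\<le>D. sym (R i)) \<and>
     (\<forall>i\<le>D. \<forall>j\<le>D. \<forall>k\<le>D. \<exists>p::nat. \<forall>x y. (x, y) \<in> R k \<longrightarrow>
          card {z. (x, z) \<in> R i \<and> (z, y) \<in> R j} = p)"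

definition bose_mesner :: "nat \<Rightarrow> (nat \<Rightarrow> ('x::finite \<times> 'x) set) \<Rightarrow> 'x cmat set" where
  "bose_mesner D R = {B. \<exists>c::nat \<Rightarrow> complex. B = (\<lambda>x y. \<Sum>i\<le>D. c i * adj (R i) x y)}"

definition primitive_idempotent :: "'x::finite cmat set \<Rightarrow> 'x cmat \<Rightarrow> bool" where
  "primitive_idempotent M E \<longleftrightarrow>
     E \<in> M \<and> mmult E E = E \<and> E \<noteq> zmat \<and>
     (\<forall>F\<in>M. mmult F F = F \<and> mmult F E = F \<longrightarrow> F = zmat \<or> F = E)"

definition primitive_idempotents :: "nat \<Rightarrow> (nat \<Rightarrow> ('x::finite \<times> 'x) set) \<Rightarrow> (nat \<Rightarrow> 'x cmat) \<Rightarrow> bool" where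
  "primitive_idempotents D R E \<longleftrightarrow>
     inj_on E {..D} \<and>
     E ` {..D} = {F. primitive_idempotent (bose_mesner D R) F} \<and>
     E 0 = (\<lambda>x y. 1 / of_nat (card (UNIV :: 'x set)))"

definition metric_scheme :: "nat \<Rightarrow> (nat \<Rightarrow> ('x \<times> 'x) set) \<Rightarrow> bool" where
  "metric_scheme D R \<longleftrightarrow>
     (\<forall>i\<le>D. \<forall>x y. (x, y) \<in> R i \<longleftrightarrow>
        ((x, y) \<in> (R 1) ^^ i \<and> (\<forall>j<i. (x, y) \<notin> (R 1) ^^ j)))"

text \<open>Cometric: E j is a polynomial of degree exactly j in E 1 under entrywise product
  (entrywise evaluation of a polynomial; the constant term multiplies J).\<close>
definition cometric :: "nat \<Rightarrow> (nat \<Rightarrow> 'x cmat) \<Rightarrow> bool" where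
  "cometric D E \<longleftrightarrow>
     (\<forall>j\<le>D. \<exists>p::complex poly. degree p = j \<and> E j = (\<lambda>x y. poly p (E 1 x y)))"

definition is_cycle_graph :: "('x::finite \<times> 'x) set \<Rightarrow> bool" where
  "is_cycle_graph G \<longleftrightarrow>
     (\<exists>(n::nat) f. n \<ge> 3 \<and> bij_betw f {..<n} UNIV \<and>
        (\<forall>i<n. \<forall>j<n. (f i, f j) \<in> G \<longleftrightarrow> (j = (i + 1) mod n \<or> i = (j + 1) mod n)))"

definition bipartite_half :: "('x \<times> 'x) set \<Rightarrow> 'x set \<Rightarrow> bool" where
  "bipartite_half G Y \<longleftrightarrow> Y \<noteq> {} \<and> Y \<noteq> UNIV \<and>
     (\<forall>x y. (x, y) \<in> G \<longrightarrow> (x \<in> Y \<longleftrightarrow> y \<notin> Y))"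

definition antipodal_double_cover :: "nat \<Rightarrow> (nat \<Rightarrow> ('x::finite \<times> 'x) set) \<Rightarrow> bool" where
  "antipodal_double_cover D R \<longleftrightarrow>
     equiv UNIV (Id \<union> R D) \<and> (\<forall>x. card {y. (x, y) \<in> Id \<union> R D} = 2)"

definition chi :: "'x set \<Rightarrow> 'x cvec" where
  "chi Y = (\<lambda>y. if y \<in> Y then 1 else 0)"

definition hat :: "'x \<Rightarrow> 'x cvec" where
  "hat x = chi {x}"

definition cinner :: "'x::finite cvec \<Rightarrow> 'x cvec \<Rightarrow> complex" where
  "cinner u v = (\<Sum>y\<in>UNIV. u y * cnj (v y))"

definition min_dist :: "nat \<Rightarrow> (nat \<Rightarrow> ('x::finite \<times> 'x) set) \<Rightarrow> 'x set \<Rightarrow> nat" where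
  "min_dist D R Y = (LEAST i. i \<noteq> 0 \<and> i \<le> D \<and> cinner (chi Y) (mvec (adj (R i)) (chi Y)) \<noteq> 0)"

definition estar :: "(nat \<Rightarrow> ('x \<times> 'x) set) \<Rightarrow> nat \<Rightarrow> 'x \<Rightarrow> 'x cmat" where
  "estar R i x = (\<lambda>y z. if y = z then adj (R i) x y else 0)"

definition astar :: "(nat \<Rightarrow> 'x::finite cmat) \<Rightarrow> nat \<Rightarrow> 'x \<Rightarrow> 'x cmat" where
  "astar E i x = (\<lambda>y z. if y = z then of_nat (card (UNIV :: 'x set)) * E i x y else 0)"

inductive_set talg :: "nat \<Rightarrow> (nat \<Rightarrow> ('x::finite \<times> 'x) set) \<Rightarrow> (nat \<Rightarrow> 'x cmat) \<Rightarrow> 'x \<Rightarrow> 'x cmat set"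
  for D R E x where
  bm: "B \<in> bose_mesner D R \<Longrightarrow> B \<in> talg D R E x"
| dual: "i \<le> D \<Longrightarrow> astar E i x \<in> talg D R E x"
| add: "B \<in> talg D R E x \<Longrightarrow> C \<in> talg D R E x \<Longrightarrow> (\<lambda>y z. B y z + C y z) \<in> talg D R E x"
| smult: "B \<in> talg D R E x \<Longrightarrow> (\<lambda>y z. c * B y z) \<in> talg D R E x"
| mult: "B \<in> talg D R E x \<Longrightarrow> C \<in> talg D R E x \<Longrightarrow> mmult B C \<in> talg D R E x"

definition csubspace :: "'x cvec set \<Rightarrow> bool" where
  "csubspace W \<longleftrightarrow> zvec \<in> W \<and> (\<forall>u\<in>W. \<forall>v\<in>W. (\<lambda>y. u y + v y) \<in> W) \<and>
     (\<forall>c. \<forall>u\<in>W. (\<lambda>y. c * u y) \<in> W)"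

definition tmodule :: "nat \<Rightarrow> (nat \<Rightarrow> ('x::finite \<times> 'x) set) \<Rightarrow> (nat \<Rightarrow> 'x cmat) \<Rightarrow> 'x \<Rightarrow> 'x cvec set \<Rightarrow> bool" where
  "tmodule D R E x W \<longleftrightarrow> csubspace W \<and> (\<forall>B\<in>talg D R E x. \<forall>w\<in>W. mvec B w \<in> W)"

definition irreducible_tmodule :: "nat \<Rightarrow> (nat \<Rightarrow> ('x::finite \<times> 'x) set) \<Rightarrow> (nat \<Rightarrow> 'x cmat) \<Rightarrow> 'x \<Rightarrow> 'x cvec set \<Rightarrow> bool" where
  "irreducible_tmodule D R E x W \<longleftrightarrow> tmodule D R E x W \<and> W \<noteq> {zvec} \<and>
     (\<forall>U. tmodule D R E x U \<and> U \<subseteq> W \<longrightarrow> U = {zvec} \<or> U = W)"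

definition endpoint :: "nat \<Rightarrow> (nat \<Rightarrow> ('x::finite \<times> 'x) set) \<Rightarrow> 'x \<Rightarrow> 'x cvec set \<Rightarrow> nat" where
  "endpoint D R x W = (LEAST i. i \<le> D \<and> (\<exists>w\<in>W. mvec (estar R i x) w \<noteq> zvec))"

definition dual_endpoint :: "nat \<Rightarrow> (nat \<Rightarrow> 'x::finite cmat) \<Rightarrow> 'x cvec set \<Rightarrow> nat" where
  "dual_endpoint D E W = (LEAST j. j \<le> D \<and> (\<exists>w\<in>W. mvec (E j) w \<noteq> zvec))"

definition lin_dep2 :: "'x cvec \<Rightarrow> 'x cvec \<Rightarrow> bool" where
  "lin_dep2 u v \<longleftrightarrow> (\<exists>a b::complex. (a, b) \<noteq> (0, 0) \<and> (\<lambda>y. a * u y + b * v y) = zvec)"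

definition relative_design :: "(nat \<Rightarrow> 'x::finite cmat) \<Rightarrow> nat \<Rightarrow> 'x \<Rightarrow> 'x cvec \<Rightarrow> bool" where
  "relative_design E t x psi \<longleftrightarrow>
     (\<forall>j. 1 \<le> j \<and> j \<le> t \<longrightarrow> lin_dep2 (mvec (E j) psi) (mvec (E j) (hat x)))"

end

theory Submission
  imports Defs "HOL-Library.Function_Algebras"
begin

text \<open>
  Suppose \<open>\<delta> \<le> t\<close>, let \<open>x \<in> Y\<close> have a codeword at distance \<open>\<delta>\<close>, and let \<open>\<psi>\<close> be the part of
  \<open>\<chi>\<^sub>Y\<close> at distance \<open>\<delta>\<close> from \<open>x\<close>. Let \<open>W\<close> be an irreducible \<open>T(x)\<close>-module orthogonal to the
  primary module. The design property makes \<open>\<psi>\<close> orthogonal to \<open>E\<^sub>j W\<close> for \<open>j \<le> t\<close>, and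
  \<open>r\<^sup>*(W) \<le> r(W)\<close> together with the tridiagonal action of \<open>A\<close> and \<open>A\<^sup>*\<close> then makes it orthogonal
  to \<open>W\<close>. So \<open>\<psi>\<close> is in the primary module, that is, constant on the sphere of radius \<open>\<delta>\<close> around
  \<open>x\<close>, which therefore lies in \<open>Y\<close>.

  A proper subset with minimum distance \<open>\<delta>\<close> that contains these spheres forces \<open>\<delta> = 2\<close> with \<open>Y\<close> a
  bipartite half, or \<open>\<delta> = D\<close> with \<open>Y\<close> an antipodal fibre: for \<open>2 < \<delta> < D\<close> one gets
  \<open>c\<^sub>\<delta>, b\<^sub>\<delta> \<le> 1\<close> and \<open>a\<^sub>\<delta> = 0\<close>, so the graph is a cycle.

  Finally, antipodal fibres have size two: each \<open>E\<^sub>j\<close> is constant on fibres or sums to zero on them,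
  and \<open>E\<^sub>1\<close> does the latter. As \<open>E\<^sub>2\<close> is a quadratic polynomial in \<open>E\<^sub>1\<close>, comparing values on \<open>R\<^sub>0\<close>,
  \<open>R\<^sub>1\<close>, \<open>R\<^bsub>D-1\<^esub>\<close>, \<open>R\<^sub>D\<close> shows that fibres have size two or \<open>E\<^sub>1\<close> takes opposite values on \<open>R\<^sub>0\<close> and
  \<open>R\<^sub>1\<close>; in the latter case it would take equal values on \<open>R\<^sub>0\<close> and \<open>R\<^sub>2\<close>, which is impossible.
\<close>

subsection \<open>Complex vectors and matrices on a finite set\<close>

definition cscale :: "complex \<Rightarrow> 'a cvec \<Rightarrow> 'a cvec" where
  "cscale c v = (\<lambda>y. c * v y)"

definition diag_mat :: "'x cvec \<Rightarrow> 'x cmat" where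
  "diag_mat d = (\<lambda>y z. if y = z then d y else 0)"

definition cadjoint :: "'x cmat \<Rightarrow> 'x cmat" where
  "cadjoint A = (\<lambda>x y. cnj (A y x))"

definition perp :: "'x::finite cvec set \<Rightarrow> 'x cvec set" where
  "perp W = {v. \<forall>w\<in>W. cinner v w = 0}"

lemma sum_fun_apply: "(\<Sum>i\<in>I. f i) y = (\<Sum>i\<in>I. f i y)" for f :: "'i \<Rightarrow> 'a \<Rightarrow> 'b::comm_monoid_add"
  by (induction I rule: infinite_finite_induct) auto

lemma hat_apply: "hat x y = (if y = x then 1 else 0)"
  by (simp add: hat_def chi_def)

lemma hat_nonzero: "hat x \<noteq> zvec"
  by (metis hat_apply zvec_def zero_neq_one)

lemma cinner_sum_left: "cinner (\<lambda>y. \<Sum>i\<in>I. f i y) w = (\<Sum>i\<in>I. cinner (f i) w)"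
  unfolding cinner_def sum_distrib_right by (rule sum.swap)

lemma cinner_sum_right: "cinner u (\<lambda>y. \<Sum>i\<in>I. f i y) = (\<Sum>i\<in>I. cinner u (f i))"
  unfolding cinner_def cnj_sum sum_distrib_left by (rule sum.swap)

lemma cinner_add_left: "cinner (\<lambda>y. u y + v y) w = cinner u w + cinner v w"
  by (simp add: cinner_def algebra_simps sum.distrib)

lemma cinner_add_right: "cinner u (\<lambda>y. v y + w y) = cinner u v + cinner u w"
  by (simp add: cinner_def algebra_simps sum.distrib)

lemma cinner_scale_left: "cinner (\<lambda>y. c * v y) w = c * cinner v w"
  by (simp add: cinner_def sum_distrib_left mult.assoc)

lemma cinner_scale_right: "cinner v (\<lambda>y. c * w y) = cnj c * cinner v w"
  by (simp add: cinner_def sum_distrib_left mult_ac)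

lemma cinner_diff_left: "cinner (\<lambda>y. u y - v y) w = cinner u w - cinner v w"
  by (simp add: cinner_def algebra_simps sum_subtractf)

lemma cinner_minus_scaled: "cinner (\<lambda>y. u y - c * v y) w = cinner u w - c * cinner v w"
  by (simp only: cinner_diff_left cinner_scale_left)

lemma cinner_zvec [simp]: "cinner zvec w = 0" "cinner u zvec = 0"
  by (simp_all add: cinner_def zvec_def)

lemma cnj_cinner: "cnj (cinner u v) = cinner v u"
  by (simp add: cinner_def mult.commute)

lemma cinner_eq_0_commute: "cinner u v = 0 \<longleftrightarrow> cinner v u = 0"
  by (metis cnj_cinner complex_cnj_zero_iff)

lemma cinner_hat_right: "cinner v (hat x) = v x"
proof -
  have "cinner v (hat x) = (\<Sum>y\<in>UNIV. if x = y then v y else 0)"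
    unfolding cinner_def by (rule sum.cong) (auto simp: hat_apply)
  then show ?thesis by simp
qed

lemma cinner_self: "cinner u u = of_real (\<Sum>y\<in>UNIV. (cmod (u y))\<^sup>2)"
  unfolding cinner_def of_real_sum complex_norm_square ..

lemma cinner_self_eq_0_iff: "cinner u u = 0 \<longleftrightarrow> u = zvec"
  unfolding cinner_self of_real_eq_0_iff by (auto simp: sum_nonneg_eq_0_iff zvec_def)

lemma perpI: "(\<And>w. w \<in> W \<Longrightarrow> cinner v w = 0) \<Longrightarrow> v \<in> perp W"
  by (simp add: perp_def)

lemma perpD: "v \<in> perp W \<Longrightarrow> w \<in> W \<Longrightarrow> cinner v w = 0"
  by (simp add: perp_def)

lemma csubspace_zvec: "csubspace W \<Longrightarrow> zvec \<in> W"
  and csubspace_add: "csubspace W \<Longrightarrow> u \<in> W \<Longrightarrow> v \<in> W \<Longrightarrow> (\<lambda>y. u y + v y) \<in> W"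
  and csubspace_scale: "csubspace W \<Longrightarrow> u \<in> W \<Longrightarrow> (\<lambda>y. c * u y) \<in> W"
  by (simp_all add: csubspace_def)

lemma csubspace_diff:
  assumes "csubspace W" "u \<in> W" "v \<in> W"
  shows "(\<lambda>y. u y - v y) \<in> W"
  using csubspace_add[OF assms(1,2) csubspace_scale[OF assms(1,3), of "- 1"]] by simp

lemma csubspace_perp: "csubspace (perp W)"
  by (auto simp: csubspace_def perp_def cinner_add_left cinner_scale_left)

interpretation cvec: vector_space "cscale :: complex \<Rightarrow> 'a cvec \<Rightarrow> 'a cvec"
  by unfold_locales (auto simp: cscale_def fun_eq_iff algebra_simps)

lemma csubspace_imp_subspace: "csubspace W \<Longrightarrow> cvec.subspace W"
  by (auto simp: csubspace_def cvec.subspace_def cscale_def zvec_def zero_fun_def plus_fun_def)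

lemma csubspace_sum:
  assumes "csubspace W" "\<And>i. i \<in> I \<Longrightarrow> f i \<in> W"
  shows "(\<lambda>y. \<Sum>i\<in>I. f i y) \<in> W"
  using cvec.subspace_sum[OF csubspace_imp_subspace[OF assms(1)], of I f] assms(2)
  by (simp add: sum_fun_apply[abs_def])

lemma independent_if_orthogonal:
  fixes B :: "'x::finite cvec set"
  assumes "finite B" and nonzero: "zvec \<notin> B"
    and orth: "\<And>v w. v \<in> B \<Longrightarrow> w \<in> B \<Longrightarrow> v \<noteq> w \<Longrightarrow> cinner v w = 0"
  shows "cvec.independent B"
proof (rule cvec.independent_if_scalars_zero[OF \<open>finite B\<close>])
  fix c v assume comb: "(\<Sum>w\<in>B. cscale (c w) w) = 0" and v: "v \<in> B"
  have "(\<lambda>y. \<Sum>w\<in>B. c w * w y) = zvec"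
    using fun_cong[OF comb] by (simp add: sum_fun_apply cscale_def zvec_def)
  then have "0 = cinner (\<lambda>y. \<Sum>w\<in>B. c w * w y) v" by simp
  also have "\<dots> = (\<Sum>w\<in>B. c w * cinner w v)" by (simp only: cinner_sum_left cinner_scale_left)
  also have "\<dots> = (\<Sum>w\<in>B. if w = v then c v * cinner v v else 0)"
    by (rule sum.cong) (auto simp: orth v)
  also have "\<dots> = c v * cinner v v" using v \<open>finite B\<close> by simp
  finally show "c v = 0" using v nonzero by (auto simp: cinner_self_eq_0_iff)
qed

lemma span_family:
  assumes "finite I" "inj_on f I" "v \<in> cvec.span (f ` I)"
  obtains c where "v = (\<lambda>y. \<Sum>i\<in>I. c i * f i y)"
proof -
  obtain u where "v = (\<Sum>w\<in>f ` I. cscale (u w) w)"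
    using assms cvec.span_finite[of "f ` I"] by auto
  also have "\<dots> = (\<Sum>i\<in>I. cscale (u (f i)) (f i))"
    by (simp add: sum.reindex[OF assms(2)])
  finally show ?thesis by (intro that[of "\<lambda>i. u (f i)"]) (auto simp: sum_fun_apply cscale_def)
qed

lemma span_range_hat: "cvec.span (range (hat :: 'a::finite \<Rightarrow> _)) = UNIV"
proof -
  have "v \<in> cvec.span (range hat)" for v :: "'a cvec"
  proof -
    have "v = (\<Sum>x\<in>UNIV. cscale (v x) (hat x))"
    proof
      fix y
      have "(\<Sum>x\<in>UNIV. cscale (v x) (hat x)) y = (\<Sum>x\<in>UNIV. if y = x then v x else 0)"
        unfolding sum_fun_apply by (rule sum.cong) (auto simp: cscale_def hat_apply)
      then show "v y = (\<Sum>x\<in>UNIV. cscale (v x) (hat x)) y" by simp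
    qed
    also have "\<dots> \<in> cvec.span (range hat)"
      by (intro cvec.span_sum cvec.span_scale cvec.span_base) simp
    finally show ?thesis .
  qed
  then show ?thesis by blast
qed

lemma independent_range_hat: "cvec.independent (range (hat :: 'a::finite \<Rightarrow> _))"
proof (rule independent_if_orthogonal)
  show "zvec \<notin> range (hat :: 'a \<Rightarrow> _)" using hat_nonzero by (metis rangeE)
qed (auto simp: cinner_hat_right hat_apply)

interpretation cvec: finite_dimensional_vector_space
  "cscale :: complex \<Rightarrow> 'a::finite cvec \<Rightarrow> _" "range hat"
  by unfold_locales (simp_all add: independent_range_hat span_range_hat)

lemma mmult_assoc: "mmult (mmult A B) C = mmult A (mmult B C)"
proof (intro ext)
  fix x y
  have "mmult (mmult A B) C x y = (\<Sum>z\<in>UNIV. \<Sum>w\<in>UNIV. A x w * B w z * C z y)"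
    by (simp add: mmult_def sum_distrib_right)
  also have "\<dots> = (\<Sum>w\<in>UNIV. \<Sum>z\<in>UNIV. A x w * B w z * C z y)" by (rule sum.swap)
  finally show "mmult (mmult A B) C x y = mmult A (mmult B C) x y"
    by (simp add: mmult_def sum_distrib_left mult.assoc)
qed

lemma mvec_mmult: "mvec (mmult A B) v = mvec A (mvec B v)"
proof
  fix x
  have "mvec (mmult A B) v x = (\<Sum>z\<in>UNIV. \<Sum>w\<in>UNIV. A x w * B w z * v z)"
    by (simp add: mvec_def mmult_def sum_distrib_right)
  also have "\<dots> = (\<Sum>w\<in>UNIV. \<Sum>z\<in>UNIV. A x w * B w z * v z)" by (rule sum.swap)
  finally show "mvec (mmult A B) v x = mvec A (mvec B v) x"
    by (simp add: mvec_def sum_distrib_left mult.assoc)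
qed

lemma trace_mmult_commute: "(\<Sum>x\<in>UNIV. mmult A B x x) = (\<Sum>x\<in>UNIV. mmult B A x x)"
  unfolding mmult_def by (subst sum.swap) (simp add: mult.commute)

lemma mmult_diag_mat_left: "mmult (diag_mat d) B = (\<lambda>y z. d y * B y z)"
proof (intro ext)
  fix y z
  have "mmult (diag_mat d) B y z = (\<Sum>w\<in>UNIV. if y = w then d y * B w z else 0)"
    unfolding mmult_def by (rule sum.cong) (auto simp: diag_mat_def)
  then show "mmult (diag_mat d) B y z = d y * B y z" by simp
qed

lemma mmult_diag_mat_right: "mmult B (diag_mat d) = (\<lambda>y z. B y z * d z)"
proof (intro ext)
  fix y z
  have "mmult B (diag_mat d) y z = (\<Sum>w\<in>UNIV. if z = w then B y w * d w else 0)"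
    unfolding mmult_def by (rule sum.cong) (auto simp: diag_mat_def)
  then show "mmult B (diag_mat d) y z = B y z * d z" by simp
qed

lemma mvec_diag_mat: "mvec (diag_mat d) v = (\<lambda>y. d y * v y)"
proof
  fix y
  have "mvec (diag_mat d) v y = (\<Sum>z\<in>UNIV. if y = z then d y * v z else 0)"
    unfolding mvec_def by (rule sum.cong) (auto simp: diag_mat_def)
  then show "mvec (diag_mat d) v y = d y * v y" by simp
qed

lemma mvec_hat: "mvec B (hat x) = (\<lambda>y. B y x)"
proof
  fix y
  have "mvec B (hat x) y = (\<Sum>z\<in>UNIV. if x = z then B y z else 0)"
    unfolding mvec_def by (rule sum.cong) (auto simp: hat_apply)
  then show "mvec B (hat x) y = B y x" by simp
qed

lemma mvec_sum: "mvec (\<lambda>x y. \<Sum>i\<in>I. F i x y) v = (\<lambda>x. \<Sum>i\<in>I. mvec (F i) v x)"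
  unfolding mvec_def sum_distrib_right by (rule ext) (rule sum.swap)

lemma mvec_scale: "mvec (\<lambda>x y. c * B x y) v = (\<lambda>x. c * mvec B v x)"
  by (simp add: mvec_def sum_distrib_left mult.assoc)

lemma mvec_add: "mvec (\<lambda>x y. B x y + C x y) v = (\<lambda>x. mvec B v x + mvec C v x)"
  by (simp add: mvec_def algebra_simps sum.distrib)

lemma cinner_mvec_cadjoint: "cinner (mvec B u) v = cinner u (mvec (cadjoint B) v)"
proof -
  have "cinner (mvec B u) v = (\<Sum>y\<in>UNIV. \<Sum>z\<in>UNIV. B y z * u z * cnj (v y))"
    by (simp add: cinner_def mvec_def sum_distrib_right)
  also have "\<dots> = (\<Sum>z\<in>UNIV. \<Sum>y\<in>UNIV. B y z * u z * cnj (v y))" by (rule sum.swap)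
  finally show ?thesis by (simp add: cinner_def mvec_def cadjoint_def sum_distrib_left mult_ac)
qed

lemma cinner_mult_left: "cinner (\<lambda>y. d y * u y) v = cinner u (\<lambda>y. cnj (d y) * v y)"
  by (simp add: cinner_def mult_ac)

lemma cadjoint_mmult: "cadjoint (mmult A B) = mmult (cadjoint B) (cadjoint A)"
  by (simp add: cadjoint_def mmult_def mult.commute)

lemma cadjoint_diag_mat: "cadjoint (diag_mat d) = diag_mat (\<lambda>y. cnj (d y))"
  by (auto simp: cadjoint_def diag_mat_def fun_eq_iff)

lemma trace_mmult_cadjoint_eq_0:
  assumes "(\<Sum>x\<in>UNIV. mmult A (cadjoint A) x x) = 0"
  shows "A = zmat"
proof -
  have "mmult A (cadjoint A) x x = cinner (A x) (A x)" for x
    by (simp add: mmult_def cadjoint_def cinner_def)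
  with assms have "(\<Sum>x\<in>UNIV. \<Sum>y\<in>UNIV. (cmod (A x y))\<^sup>2) = 0"
    by (simp only: cinner_self flip: of_real_sum) (simp only: of_real_eq_0_iff)
  then show ?thesis by (auto simp: sum_nonneg_eq_0_iff sum_nonneg zmat_def)
qed

lemma mmult_diag_mat_between_projections_eq_0:
  assumes F: "cadjoint F = F" "mmult F F = F" and G: "cadjoint G = G" "mmult G G = G"
    and d: "\<And>y. cnj (d y) = d y"
    and sum_0: "(\<Sum>u\<in>UNIV. \<Sum>v\<in>UNIV. d u * (G u v * F v u) * d v) = 0"
  shows "mmult F (mmult (diag_mat d) G) = zmat"
proof (rule trace_mmult_cadjoint_eq_0)
  let ?d = "diag_mat d"
  let ?N = "mmult F (mmult ?d G)" and ?L = "mmult ?d (mmult G ?d)"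
  have "cadjoint ?N = mmult G (mmult ?d F)"
    by (simp add: cadjoint_mmult cadjoint_diag_mat F G d mmult_assoc)
  then have "mmult ?N (cadjoint ?N) = mmult F (mmult ?d (mmult (mmult G G) (mmult ?d F)))"
    by (simp only: mmult_assoc)
  also have "\<dots> = mmult F (mmult ?L F)" by (simp only: G mmult_assoc)
  finally have "(\<Sum>x\<in>UNIV. mmult ?N (cadjoint ?N) x x) = (\<Sum>x\<in>UNIV. mmult F (mmult ?L F) x x)"
    by simp
  also have "\<dots> = (\<Sum>x\<in>UNIV. mmult ?L F x x)"
    by (subst trace_mmult_commute) (simp only: mmult_assoc F)
  also have "\<dots> = (\<Sum>u\<in>UNIV. \<Sum>v\<in>UNIV. d u * (G u v * F v u) * d v)"
    by (simp add: mmult_diag_mat_left mmult_diag_mat_right mmult_def[of _ F] mult_ac)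
  finally show "(\<Sum>x\<in>UNIV. mmult ?N (cadjoint ?N) x x) = 0" by (simp only: sum_0)
qed

lemma mmult_adj_left: "mmult (adj S) B x y = (\<Sum>z\<in>S `` {x}. B z y)"
proof -
  have "mmult (adj S) B x y = (\<Sum>z\<in>UNIV. if (x, z) \<in> S then B z y else 0)"
    unfolding mmult_def by (rule sum.cong) (auto simp: adj_def)
  then show ?thesis by (simp add: sum.If_cases Image_singleton)
qed

lemma cinner_chi_adj: "cinner (chi Y) (mvec (adj S) (chi Y)) = of_nat (card (S \<inter> Y \<times> Y))"
proof -
  have "cinner (chi Y) (mvec (adj S) (chi Y)) =
    (\<Sum>u\<in>UNIV. \<Sum>v\<in>UNIV. if (u, v) \<in> S \<inter> Y \<times> Y then 1 else 0)"
    unfolding cinner_def mvec_def cnj_sum sum_distrib_left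
    by (intro sum.cong refl) (auto simp: chi_def adj_def)
  also have "\<dots> = (\<Sum>p\<in>UNIV \<times> UNIV. if p \<in> S \<inter> Y \<times> Y then 1 else 0)"
    unfolding sum.cartesian_product by (rule sum.cong) (auto split: if_splits)
  also have "\<dots> = of_nat (card (S \<inter> Y \<times> Y))" by (simp add: sum.If_cases Int_def)
  finally show ?thesis .
qed

subsection \<open>Association schemes\<close>

locale association_scheme =
  fixes D :: nat and R :: "nat \<Rightarrow> ('x::finite \<times> 'x) set"
  assumes scheme: "assoc_scheme D R"
begin

definition idx :: "'x \<Rightarrow> 'x \<Rightarrow> nat" where
  "idx x y = (THE i. i \<le> D \<and> (x, y) \<in> R i)"

definition sphere :: "'x \<Rightarrow> nat \<Rightarrow> 'x set" where
  "sphere x i = {y. idx x y = i}"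

definition intersection_number :: "nat \<Rightarrow> nat \<Rightarrow> nat \<Rightarrow> nat" where
  "intersection_number i j k = (THE n. \<forall>x y. idx x y = k \<longrightarrow> card (sphere x i \<inter> sphere y j) = n)"

definition valency :: "nat \<Rightarrow> nat" where
  "valency i = intersection_number i i 0"

lemma ex1_relation: "\<exists>!i. i \<le> D \<and> (x, y) \<in> R i"
  using scheme by (simp add: assoc_scheme_def)

lemma idx_le: "idx x y \<le> D" and in_R_idx: "(x, y) \<in> R (idx x y)"
  using theI'[OF ex1_relation[of x y]] by (simp_all add: idx_def)

lemma in_R_iff: "i \<le> D \<Longrightarrow> (x, y) \<in> R i \<longleftrightarrow> idx x y = i"
  using ex1_relation[of x y] idx_le in_R_idx by blast

lemma D_pos: "1 \<le> D"
  using scheme by (simp add: assoc_scheme_def)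

lemma idx_eq_0_iff: "idx x y = 0 \<longleftrightarrow> x = y"
  using in_R_iff[of 0 x y] scheme by (auto simp: assoc_scheme_def)

lemma idx_self [simp]: "idx x x = 0"
  by (simp add: idx_eq_0_iff)

lemma idx_commute: "idx x y = idx y x"
proof -
  have "sym (R (idx x y))" using scheme idx_le by (simp add: assoc_scheme_def)
  then have "(y, x) \<in> R (idx x y)" using in_R_idx by (meson symD)
  then show ?thesis using in_R_iff idx_le by metis
qed

lemma in_sphere_iff [simp]: "y \<in> sphere x i \<longleftrightarrow> idx x y = i"
  by (simp add: sphere_def)

lemma sphere_eq_Image: "i \<le> D \<Longrightarrow> sphere x i = R i `` {x}"
  by (auto simp: in_R_iff)

lemma card_sphere_Int_cong:
  assumes "idx x y = idx x' y'"
  shows "card (sphere x i \<inter> sphere y j) = card (sphere x' i \<inter> sphere y' j)"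
proof (cases "i \<le> D \<and> j \<le> D")
  case True
  then have "\<exists>p. \<forall>u v. (u, v) \<in> R (idx x y) \<longrightarrow> card {z. (u, z) \<in> R i \<and> (z, v) \<in> R j} = p"
    using scheme idx_le[of x y] by (simp add: assoc_scheme_def)
  moreover have "{z. (u, z) \<in> R i \<and> (z, v) \<in> R j} = sphere u i \<inter> sphere v j" for u v
    using True idx_commute[of v] by (auto simp: in_R_iff)
  ultimately show ?thesis using in_R_idx[of x y] in_R_idx[of x' y'] assms by metis
next
  case False
  then have "sphere u i \<inter> sphere v j = {}" for u v
    using idx_le[of u] idx_le[of v] by auto
  then show ?thesis by simp
qed

lemma card_sphere_Int: "card (sphere x i \<inter> sphere y j) = intersection_number i j (idx x y)"
  unfolding intersection_number_def
  by (rule the_equality[symmetric]) (auto intro: card_sphere_Int_cong)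

lemma sphere_Int_empty_iff: "sphere x i \<inter> sphere y j = {} \<longleftrightarrow> intersection_number i j (idx x y) = 0"
  by (simp flip: card_sphere_Int)

lemma card_sphere: "card (sphere x i) = valency i"
  using card_sphere_Int[of x i x i] by (simp add: valency_def)

lemma ex_idx:
  assumes "i \<le> D"
  obtains y where "idx x y = i"
proof -
  have "R i \<noteq> {}" using scheme assms by (simp add: assoc_scheme_def)
  then obtain u v where "(u, v) \<in> R i" by auto
  then have "v \<in> sphere u i" using assms by (simp add: in_R_iff)
  then have "card (sphere x i) \<noteq> 0" by (metis card_sphere card_eq_0_iff emptyE finite)
  with that show ?thesis by (metis card.empty ex_in_conv in_sphere_iff)
qed

lemma sum_idx:
  fixes f :: "nat \<Rightarrow> nat \<Rightarrow> 'b::comm_semiring_1"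
  shows "(\<Sum>z\<in>UNIV. f (idx x z) (idx y z)) =
    (\<Sum>i\<le>D. \<Sum>j\<le>D. of_nat (intersection_number i j (idx x y)) * f i j)"
proof -
  have "(\<Sum>z\<in>UNIV. f (idx x z) (idx y z)) =
    (\<Sum>p\<in>{..D} \<times> {..D}. \<Sum>z | z \<in> UNIV \<and> (idx x z, idx y z) = p. f (idx x z) (idx y z))"
    by (rule sum.group[symmetric]) (auto simp: idx_le)
  also have "\<dots> = (\<Sum>(i, j)\<in>{..D} \<times> {..D}. of_nat (intersection_number i j (idx x y)) * f i j)"
  proof (intro sum.cong refl, clarify)
    fix i j
    have "(\<Sum>z | z \<in> UNIV \<and> (idx x z, idx y z) = (i, j). f (idx x z) (idx y z)) =
      (\<Sum>z\<in>sphere x i \<inter> sphere y j. f i j)"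
      by (rule sum.cong) auto
    then show "(\<Sum>z | z \<in> UNIV \<and> (idx x z, idx y z) = (i, j). f (idx x z) (idx y z)) =
      of_nat (intersection_number i j (idx x y)) * f i j"
      by (simp add: card_sphere_Int)
  qed
  finally show ?thesis by (simp add: sum.cartesian_product)
qed

abbreviation M :: "'x cmat set" where "M \<equiv> bose_mesner D R"

lemma adj_R: "i \<le> D \<Longrightarrow> adj (R i) = (\<lambda>x y. if idx x y = i then 1 else 0)"
  by (auto simp: adj_def in_R_iff fun_eq_iff)

lemma sum_adj_R: "(\<Sum>i\<le>D. c i * adj (R i) x y) = c (idx x y)"
proof -
  have "(\<Sum>i\<le>D. c i * adj (R i) x y) = (\<Sum>i\<le>D. if idx x y = i then c i else 0)"
    by (rule sum.cong) (auto simp: adj_R)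
  then show ?thesis by (simp add: idx_le)
qed

lemma bose_mesner_iff: "B \<in> M \<longleftrightarrow> (\<exists>c. B = (\<lambda>x y. c (idx x y)))"
  by (simp add: bose_mesner_def sum_adj_R)

lemma bose_mesnerI: "(\<lambda>x y. c (idx x y)) \<in> M"
  by (auto simp: bose_mesner_iff)

lemma bose_mesnerE:
  assumes "B \<in> M"
  obtains c where "B = (\<lambda>x y. c (idx x y))"
  using assms by (auto simp: bose_mesner_iff)

lemma bose_mesner_cong: "B \<in> M \<Longrightarrow> idx x y = idx x' y' \<Longrightarrow> B x y = B x' y'"
  by (auto simp: bose_mesner_iff)

lemma bose_mesner_sym: "B \<in> M \<Longrightarrow> B x y = B y x"
  by (rule bose_mesner_cong) (auto intro: idx_commute)

lemma bose_mesner_eqI: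
  assumes "B \<in> M" "C \<in> M" "\<And>y. B x y = C x y"
  shows "B = C"
proof (intro ext)
  fix u v
  obtain y where "idx x y = idx u v" using ex_idx[OF idx_le] by blast
  with assms show "B u v = C u v" by (metis bose_mesner_cong)
qed

lemma adj_R_in_bose_mesner: "i \<le> D \<Longrightarrow> adj (R i) \<in> M"
  unfolding adj_R by (rule bose_mesnerI[of "\<lambda>k. if k = i then 1 else 0"])

lemma bose_mesner_cnj: "B \<in> M \<Longrightarrow> (\<lambda>x y. cnj (B x y)) \<in> M"
  by (auto simp: bose_mesner_iff)

lemma bose_mesner_hadamard: "B \<in> M \<Longrightarrow> C \<in> M \<Longrightarrow> (\<lambda>x y. B x y * C x y) \<in> M"
  by (auto simp: bose_mesner_iff intro: exI[of _ "\<lambda>k. _ k * _ k"])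

lemma bose_mesner_linear_combination:
  assumes "\<And>j. j \<in> J \<Longrightarrow> F j \<in> M"
  shows "(\<lambda>x y. \<Sum>j\<in>J. \<beta> j * F j x y) \<in> M"
proof -
  obtain f where "\<And>j. j \<in> J \<Longrightarrow> F j = (\<lambda>x y. f j (idx x y))"
    using assms unfolding bose_mesner_iff by metis
  then have "(\<lambda>x y. \<Sum>j\<in>J. \<beta> j * F j x y) = (\<lambda>x y. \<Sum>j\<in>J. \<beta> j * f j (idx x y))" by simp
  then show ?thesis by (simp only: bose_mesnerI[of "\<lambda>k. \<Sum>j\<in>J. \<beta> j * f j k"])
qed

lemma bose_mesner_mmult:
  assumes "B \<in> M" "C \<in> M"
  shows "mmult B C \<in> M"
proof -
  obtain b c where "B = (\<lambda>x y. b (idx x y))" "C = (\<lambda>x y. c (idx x y))"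
    using assms by (elim bose_mesnerE)
  then have "mmult B C = (\<lambda>x y. \<Sum>i\<le>D. \<Sum>j\<le>D.
      of_nat (intersection_number i j (idx x y)) * (b i * c j))"
    by (simp add: mmult_def idx_commute[of _ y for y] sum_idx[of "\<lambda>i j. b i * c j"])
  then show ?thesis
    by (simp only: bose_mesnerI[of
          "\<lambda>k. \<Sum>i\<le>D. \<Sum>j\<le>D. of_nat (intersection_number i j k) * (b i * c j)"])
qed

lemma bose_mesner_mmult_commute:
  assumes "B \<in> M" "C \<in> M"
  shows "mmult B C = mmult C B"
proof (intro ext)
  fix x y
  have "mmult B C x y = mmult B C y x" using assms by (intro bose_mesner_sym bose_mesner_mmult)
  also have "\<dots> = (\<Sum>z\<in>UNIV. C x z * B z y)"
    unfolding mmult_def using bose_mesner_sym[OF assms(1)] bose_mesner_sym[OF assms(2)]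
    by (intro sum.cong refl) (metis mult.commute)
  finally show "mmult B C x y = mmult C B x y" by (simp add: mmult_def)
qed

lemma bose_mesner_cadjoint: "B \<in> M \<Longrightarrow> cadjoint B = (\<lambda>x y. cnj (B x y))"
  unfolding cadjoint_def by (metis bose_mesner_sym)

lemma mmult_adj_R:
  assumes "i \<le> D" "j \<le> D"
  shows "mmult (adj (R i)) (adj (R j)) = (\<lambda>x y. of_nat (intersection_number i j (idx x y)))"
proof (intro ext)
  fix x y
  have "mmult (adj (R i)) (adj (R j)) x y = (\<Sum>z\<in>sphere x i. if z \<in> sphere y j then 1 else 0)"
    unfolding mmult_adj_left sphere_eq_Image[OF assms(1), symmetric]
    by (simp add: adj_R assms(2) idx_commute[of y])
  also have "\<dots> = of_nat (card (sphere x i \<inter> sphere y j))" by (simp add: sum.If_cases Int_def)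
  finally show "mmult (adj (R i)) (adj (R j)) x y = of_nat (intersection_number i j (idx x y))"
    by (simp only: card_sphere_Int)
qed

definition primary :: "'x \<Rightarrow> 'x cvec set" where
  "primary x = (\<lambda>B. mvec B (hat x)) ` M"

lemma primary_eq_range: "primary x = range (\<lambda>f y. f (idx x y))"
proof -
  have "M = range (\<lambda>c x y. c (idx x y))" by (auto simp: bose_mesner_iff)
  moreover have "mvec (\<lambda>x y. f (idx x y)) (hat x) = (\<lambda>y. f (idx x y))" for f
    by (simp add: mvec_hat idx_commute[of _ x])
  ultimately show ?thesis by (simp add: primary_def image_image)
qed

lemma primaryI: "(\<lambda>y. f (idx x y)) \<in> primary x"
  by (simp add: primary_eq_range)

lemma primaryE:
  assumes "v \<in> primary x"
  obtains f where "v = (\<lambda>y. f (idx x y))"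
  using assms by (auto simp: primary_eq_range)

lemma hat_in_primary: "hat x \<in> primary x"
proof -
  have "hat x = (\<lambda>y. if idx x y = 0 then 1 else 0)"
    by (auto simp: hat_apply idx_eq_0_iff fun_eq_iff)
  then show ?thesis by (simp only: primaryI[of "\<lambda>k. if k = 0 then 1 else 0"])
qed

lemma min_dist_eq_Least: "min_dist D R Y = (LEAST i. \<exists>x\<in>Y. \<exists>y\<in>Y. x \<noteq> y \<and> idx x y = i)"
proof -
  have "i \<noteq> 0 \<and> i \<le> D \<and> cinner (chi Y) (mvec (adj (R i)) (chi Y)) \<noteq> 0
      \<longleftrightarrow> (\<exists>x\<in>Y. \<exists>y\<in>Y. x \<noteq> y \<and> idx x y = i)" for i
  proof (cases "i \<le> D")
    case True
    then have "R i \<inter> Y \<times> Y \<noteq> {} \<longleftrightarrow> (\<exists>x\<in>Y. \<exists>y\<in>Y. idx x y = i)"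
      using in_R_iff[OF True] by blast
    then show ?thesis using True by (simp add: cinner_chi_adj) (metis idx_eq_0_iff neq0_conv)
  qed (use idx_le in auto)
  then show ?thesis by (simp only: min_dist_def)
qed

lemma min_dist_attained:
  assumes "1 < card Y"
  shows "\<exists>x\<in>Y. \<exists>y\<in>Y. x \<noteq> y \<and> idx x y = min_dist D R Y"
proof -
  obtain x y where "x \<in> Y" "y \<in> Y" "x \<noteq> y"
    using assms by (metis card_le_Suc0_iff_eq finite One_nat_def not_less)
  then have "\<exists>i. \<exists>x\<in>Y. \<exists>y\<in>Y. x \<noteq> y \<and> idx x y = i" by blast
  then show ?thesis unfolding min_dist_eq_Least by (rule LeastI_ex)
qed

lemma min_dist_le: "x \<in> Y \<Longrightarrow> y \<in> Y \<Longrightarrow> x \<noteq> y \<Longrightarrow> min_dist D R Y \<le> idx x y"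
  unfolding min_dist_eq_Least by (rule Least_le) blast

end

subsection \<open>Primitive idempotents\<close>

locale association_scheme_idempotents = association_scheme D R
  for D and R :: "nat \<Rightarrow> ('x::finite \<times> 'x) set" +
  fixes E :: "nat \<Rightarrow> 'x cmat"
  assumes idempotents: "primitive_idempotents D R E"
begin

lemma primitive_idempotent_E: "j \<le> D \<Longrightarrow> primitive_idempotent M (E j)"
  using idempotents unfolding primitive_idempotents_def by blast

lemma E_in_bose_mesner: "j \<le> D \<Longrightarrow> E j \<in> M"
  and E_idempotent: "j \<le> D \<Longrightarrow> mmult (E j) (E j) = E j"
  and E_nonzero: "j \<le> D \<Longrightarrow> E j \<noteq> zmat"
  using primitive_idempotent_E unfolding primitive_idempotent_def by blast+

lemma E_minimal:
  "j \<le> D \<Longrightarrow> F \<in> M \<Longrightarrow> mmult F F = F \<Longrightarrow> mmult F (E j) = F \<Longrightarrow> F = zmat \<or> F = E j"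
  using primitive_idempotent_E unfolding primitive_idempotent_def by blast

lemma mmult_idempotent_E:
  assumes "j \<le> D" "F \<in> M" "mmult F F = F"
  shows "mmult F (E j) = zmat \<or> mmult F (E j) = E j"
proof (rule E_minimal[OF \<open>j \<le> D\<close>])
  have commute: "mmult F (E j) = mmult (E j) F"
    using assms by (intro bose_mesner_mmult_commute E_in_bose_mesner)
  show "mmult F (E j) \<in> M" using assms by (intro bose_mesner_mmult E_in_bose_mesner)
  show "mmult (mmult F (E j)) (E j) = mmult F (E j)"
    using assms by (simp add: mmult_assoc E_idempotent)
  have "mmult (mmult F (E j)) (mmult F (E j)) = mmult (mmult F F) (mmult (E j) (E j))"
    by (metis commute mmult_assoc)
  then show "mmult (mmult F (E j)) (mmult F (E j)) = mmult F (E j)"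
    using assms by (simp add: E_idempotent)
qed

lemma mmult_E:
  assumes "i \<le> D" "j \<le> D"
  shows "mmult (E i) (E j) = (if i = j then E j else zmat)"
proof (cases "i = j")
  case False
  have "mmult (E i) (E j) = mmult (E j) (E i)"
    using assms by (intro bose_mesner_mmult_commute E_in_bose_mesner)
  moreover have "E i \<noteq> E j"
    using idempotents False assms by (auto simp: primitive_idempotents_def inj_on_def)
  ultimately show ?thesis
    using False mmult_idempotent_E[of j "E i"] mmult_idempotent_E[of i "E j"] assms
    by (auto simp: E_in_bose_mesner E_idempotent)
qed (simp add: assms E_idempotent)

lemma E_sym: "j \<le> D \<Longrightarrow> E j x y = E j y x"
  by (intro bose_mesner_sym E_in_bose_mesner)

text \<open>The product of \<open>E\<^sub>j\<close> and its adjoint is a nonzero idempotent below \<open>E\<^sub>j\<close>, hence \<open>E\<^sub>j\<close> itself.\<close>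

lemma cadjoint_E:
  assumes "j \<le> D"
  shows "cadjoint (E j) = E j"
proof -
  let ?F = "cadjoint (E j)"
  have F: "?F \<in> M" using bose_mesner_cnj E_in_bose_mesner assms by (simp add: bose_mesner_cadjoint)
  have FF: "mmult ?F ?F = ?F" using E_idempotent[OF assms] by (metis cadjoint_mmult)
  have commute: "mmult ?F (E j) = mmult (E j) ?F"
    by (intro bose_mesner_mmult_commute F E_in_bose_mesner assms)
  have "mmult (E j) ?F \<noteq> zmat"
  proof
    assume "mmult (E j) ?F = zmat"
    then have "E j = zmat" by (intro trace_mmult_cadjoint_eq_0) (simp add: zmat_def)
    with E_nonzero[OF assms] show False by blast
  qed
  then have "mmult (E j) ?F = E j" using mmult_idempotent_E[OF assms F FF] commute by simp
  moreover have "cadjoint (mmult (E j) ?F) = mmult (E j) ?F"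
    by (simp add: cadjoint_mmult) (simp add: cadjoint_def)
  ultimately show ?thesis by metis
qed

lemma E_real: "j \<le> D \<Longrightarrow> cnj (E j x y) = E j x y"
  using cadjoint_E bose_mesner_cadjoint E_in_bose_mesner by metis

lemma cinner_E_rows:
  assumes "i \<le> D" "j \<le> D"
  shows "cinner (E i x) (E j y) = (if i = j then E j x y else 0)"
proof -
  have "cinner (E i x) (E j y) = mmult (E i) (E j) x y"
    unfolding cinner_def mmult_def using E_sym[OF assms(2)] E_real[OF assms(2)] by metis
  then show ?thesis using assms by (simp add: mmult_E zmat_def)
qed

lemma E_row_nonzero:
  assumes "j \<le> D"
  shows "E j x \<noteq> zvec"
proof
  assume "E j x = zvec"
  moreover have "zmat \<in> M" unfolding zmat_def by (rule bose_mesnerI)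
  ultimately have "E j = zmat"
    using assms by (intro bose_mesner_eqI[of _ _ x]) (auto simp: E_in_bose_mesner zmat_def zvec_def)
  with E_nonzero[OF assms] show False by blast
qed

lemma E_diag_nonzero: "j \<le> D \<Longrightarrow> E j x x \<noteq> 0"
  using E_row_nonzero[of j x] cinner_E_rows[of j j x x] by (auto simp: cinner_self_eq_0_iff)

lemma E_row_inj:
  assumes "i \<le> D" "j \<le> D" "E i x = E j x"
  shows "i = j"
  using assms cinner_E_rows[of i j x x] E_row_nonzero[of j x]
  by (auto simp: cinner_self_eq_0_iff split: if_splits)

text \<open>The rows of the \<open>E\<^sub>j\<close> at \<open>x\<close> are \<open>D + 1\<close> independent vectors in the space of rows of \<open>M\<close> at
  \<open>x\<close>, which the \<open>D + 1\<close> rows of the \<open>A\<^sub>i\<close> span.\<close>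

lemma bose_mesner_E_expansion:
  assumes B: "B \<in> M"
  obtains \<beta> where "B = (\<lambda>x y. \<Sum>j\<le>D. \<beta> j * E j x y)"
proof -
  fix x :: 'x
  let ?e = "\<lambda>j. E j x" and ?a = "\<lambda>i. adj (R i) x" and ?rows = "(\<lambda>C. C x) ` M"
  have inj: "inj_on ?e {..D}" by (auto intro: inj_onI E_row_inj)
  have "cvec.independent (?e ` {..D})"
  proof (rule independent_if_orthogonal)
    show "zvec \<notin> ?e ` {..D}" using E_row_nonzero by (metis atMost_iff imageE)
  qed (auto simp: cinner_E_rows)
  moreover have "?rows \<subseteq> cvec.span (?a ` {..D})"
  proof clarify
    fix C assume "C \<in> M"
    then obtain c where "C = (\<lambda>x y. \<Sum>i\<le>D. c i * adj (R i) x y)" by (auto simp: bose_mesner_def)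
    then have "C x = (\<Sum>i\<le>D. cscale (c i) (?a i))"
      by (auto simp: fun_eq_iff sum_fun_apply cscale_def)
    also have "\<dots> \<in> cvec.span (?a ` {..D})"
      by (intro cvec.span_sum cvec.span_scale cvec.span_base) simp
    finally show "C x \<in> cvec.span (?a ` {..D})" .
  qed
  then have "cvec.dim ?rows \<le> card (?a ` {..D})" by (rule cvec.dim_le_card) simp
  with card_image_le[of "{..D}" ?a] card_image[OF inj] have "cvec.dim ?rows \<le> card (?e ` {..D})"
    by simp
  ultimately have "?rows \<subseteq> cvec.span (?e ` {..D})"
    by (intro cvec.card_ge_dim_independent) (auto simp: E_in_bose_mesner)
  with B have "B x \<in> cvec.span (?e ` {..D})" by blast
  with inj obtain \<beta> where "B x = (\<lambda>y. \<Sum>j\<le>D. \<beta> j * E j x y)"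
    by (rule span_family[OF finite_atMost])
  then have "B = (\<lambda>x y. \<Sum>j\<le>D. \<beta> j * E j x y)"
    by (intro bose_mesner_eqI[OF B, of _ x] bose_mesner_linear_combination)
      (auto simp: E_in_bose_mesner dest: fun_cong)
  then show ?thesis by (rule that)
qed

lemma mmult_E_expansion:
  assumes "k \<le> D"
  shows "mmult (\<lambda>x y. \<Sum>j\<le>D. \<beta> j * E j x y) (E k) = (\<lambda>x y. \<beta> k * E k x y)"
proof (intro ext)
  fix x y
  have "mmult (\<lambda>x y. \<Sum>j\<le>D. \<beta> j * E j x y) (E k) x y = (\<Sum>z\<in>UNIV. \<Sum>j\<le>D. \<beta> j * (E j x z * E k z y))"
    by (simp add: mmult_def sum_distrib_right mult.assoc)
  also have "\<dots> = (\<Sum>j\<le>D. \<Sum>z\<in>UNIV. \<beta> j * (E j x z * E k z y))" by (rule sum.swap)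
  also have "\<dots> = (\<Sum>j\<le>D. \<beta> j * mmult (E j) (E k) x y)" by (simp add: mmult_def sum_distrib_left)
  also have "\<dots> = (\<Sum>j\<le>D. if j = k then \<beta> k * E k x y else 0)"
    using assms by (intro sum.cong) (auto simp: mmult_E zmat_def)
  finally show "mmult (\<lambda>x y. \<Sum>j\<le>D. \<beta> j * E j x y) (E k) x y = \<beta> k * E k x y" using assms by simp
qed

lemma bose_mesner_eigenvalue:
  assumes "B \<in> M" "k \<le> D"
  obtains \<theta> where "mmult B (E k) = (\<lambda>x y. \<theta> * E k x y)"
proof -
  obtain \<beta> where "B = (\<lambda>x y. \<Sum>j\<le>D. \<beta> j * E j x y)" by (rule bose_mesner_E_expansion[OF assms(1)])
  then have "mmult B (E k) = (\<lambda>x y. \<beta> k * E k x y)" by (simp only: mmult_E_expansion[OF assms(2)])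
  then show ?thesis by (rule that)
qed

lemma sum_E: "(\<Sum>j\<le>D. E j x y) = (if x = y then 1 else 0)"
proof -
  define I :: "'x cmat" where "I = diag_mat (\<lambda>_. 1)"
  have "I = (\<lambda>x y. if idx x y = 0 then 1 else 0)" by (simp add: I_def diag_mat_def idx_eq_0_iff)
  then have "I \<in> M" by (simp only: bose_mesnerI[of "\<lambda>k. if k = 0 then 1 else 0"])
  then obtain \<beta> where \<beta>: "I = (\<lambda>x y. \<Sum>j\<le>D. \<beta> j * E j x y)" by (rule bose_mesner_E_expansion)
  have "\<beta> k = 1" if "k \<le> D" for k
  proof -
    have "E k = mmult I (E k)" by (simp add: I_def mmult_diag_mat_left)
    also have "\<dots> = (\<lambda>x y. \<beta> k * E k x y)" unfolding \<beta> by (rule mmult_E_expansion[OF that])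
    finally have "E k x x = \<beta> k * E k x x" by (rule fun_cong[THEN fun_cong])
    then show ?thesis using E_diag_nonzero[OF that, of x] by simp
  qed
  then have "(\<Sum>j\<le>D. E j x y) = (\<Sum>j\<le>D. \<beta> j * E j x y)" by simp
  also have "\<dots> = I x y" using fun_cong[OF fun_cong[OF \<beta>], of x y] by simp
  finally show ?thesis by (simp add: I_def diag_mat_def)
qed

lemma sum_mvec_E: "(\<Sum>j\<le>D. mvec (E j) v y) = v y"
proof -
  have "(\<Sum>j\<le>D. mvec (E j) v y) = mvec (\<lambda>x y. \<Sum>j\<le>D. E j x y) v y" by (simp only: mvec_sum)
  also have "\<dots> = v y"
    using fun_cong[OF mvec_diag_mat[of "\<lambda>_. 1" v], of y] by (simp add: sum_E diag_mat_def)
  finally show ?thesis .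
qed

text \<open>Up to a positive factor, \<open>krein_sum h i j\<close> is the Krein parameter \<open>q\<^sup>h\<^sub>i\<^sub>j\<close>.\<close>

definition krein_sum :: "nat \<Rightarrow> nat \<Rightarrow> nat \<Rightarrow> complex" where
  "krein_sum h i j = (\<Sum>y\<in>UNIV. \<Sum>z\<in>UNIV. E h y z * E i y z * E j y z)"

lemma krein_sum_commute: "krein_sum h i j = krein_sum h j i"
  by (simp add: krein_sum_def mult_ac)

theorem krein_sum_eq_0_imp_triple_product_eq_0:
  assumes le: "h \<le> D" "i \<le> D" "j \<le> D" and krein: "krein_sum h i j = 0"
  shows "mmult (E i) (mmult (diag_mat (E h x)) (E j)) = zmat"
proof (rule mmult_diag_mat_between_projections_eq_0)
  define H where "H = (\<lambda>y z. E j y z * E i y z)"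
  have H: "H \<in> M" unfolding H_def by (intro bose_mesner_hadamard E_in_bose_mesner le)
  have "of_nat (card (UNIV :: 'x set)) * mmult H (E h) x x 
      = (\<Sum>w\<in>(UNIV :: 'x set). mmult H (E h) x x)"
    by simp
  also have "\<dots> = (\<Sum>w\<in>UNIV. mmult H (E h) w w)"
    by (intro sum.cong refl bose_mesner_cong[OF bose_mesner_mmult[OF H E_in_bose_mesner[OF le(1)]]])
      simp
  also have "\<dots> = krein_sum h i j"
    unfolding mmult_def H_def krein_sum_def
    by (intro sum.cong refl) (simp add: E_sym[OF le(1), of z y for y z] mult_ac)
  finally have diag_0: "mmult H (E h) x x = 0" using krein by simp
  have "(\<Sum>u\<in>UNIV. \<Sum>v\<in>UNIV. E h x u * (E j u v * E i v u) * E h x v)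
      = mmult (E h) (mmult H (E h)) x x"
    by (simp add: mmult_def H_def sum_distrib_left E_sym[OF le(1), of _ x]
        E_sym[OF le(2), of u v for u v] mult_ac)
  also have "mmult (E h) (mmult H (E h)) = mmult H (E h)"
    by (metis H E_in_bose_mesner E_idempotent le(1) bose_mesner_mmult_commute mmult_assoc)
  finally show "(\<Sum>u\<in>UNIV. \<Sum>v\<in>UNIV. E h x u * (E j u v * E i v u) * E h x v) = 0"
    using diag_0 by simp
qed (simp_all add: le cadjoint_E E_idempotent E_real)

end

subsection \<open>Cometric schemes\<close>

locale cometric_association_scheme = association_scheme_idempotents D R E
  for D and R :: "nat \<Rightarrow> ('x::finite \<times> 'x) set" and E +
  assumes cometric: "cometric D E"
begin

lemma E_polynomial:
  assumes "j \<le> D"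
  obtains p where "degree p = j" "\<And>x y. E j x y = poly p (E 1 x y)"
  using cometric assms unfolding cometric_def by metis

lemma E1_inj:
  assumes eq: "E 1 x y = E 1 x' y'"
  shows "idx x y = idx x' y'"
proof -
  have E_eq: "E j x y = E j x' y'" if "j \<le> D" for j
    using E_polynomial[OF that] eq by metis
  obtain \<beta> where "(\<lambda>x y. of_nat (idx x y)) = (\<lambda>x y. \<Sum>j\<le>D. \<beta> j * E j x y)"
    by (rule bose_mesner_E_expansion[OF bose_mesnerI[of of_nat]])
  then have expansion: "of_nat (idx u v) = (\<Sum>j\<le>D. \<beta> j * E j u v)" for u v by (auto dest: fun_cong)
  have "(of_nat (idx x y) :: complex) = of_nat (idx x' y')" unfolding expansion by (simp add: E_eq)
  then show ?thesis by simp
qed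

lemma poly_E1_expansion:
  assumes "n \<le> Suc D" "\<And>k. n \<le> k \<Longrightarrow> coeff p k = 0"
  shows "\<exists>\<beta>. \<forall>x y. poly p (E 1 x y) = (\<Sum>j<n. \<beta> j * E j x y)"
  using assms
proof (induction n arbitrary: p)
  case 0
  then have "p = 0" by (intro poly_eqI) simp
  then show ?case by simp
next
  case (Suc n)
  then have "n \<le> D" by simp
  then obtain q where q: "degree q = n" "\<And>x y. E n x y = poly q (E 1 x y)"
    using E_polynomial by metis
  have "q \<noteq> 0" using q(2) E_nonzero[OF \<open>n \<le> D\<close>] by (auto simp: zmat_def fun_eq_iff)
  then have lead: "coeff q n \<noteq> 0" using q(1) leading_coeff_0_iff[of q] by simp
  define c where "c = coeff p n / coeff q n"
  have "coeff (p - smult c q) k = 0" if "n \<le> k" for k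
    using that Suc.prems(2)[of k] lead q(1) by (cases "k = n") (auto simp: c_def coeff_eq_0)
  then obtain \<beta> where \<beta>: "\<And>x y. poly (p - smult c q) (E 1 x y) = (\<Sum>j<n. \<beta> j * E j x y)"
    using Suc.IH[of "p - smult c q"] \<open>n \<le> D\<close> by auto
  have "poly p (E 1 x y) = (\<Sum>j<Suc n. (\<beta>(n := c)) j * E j x y)" for x y
  proof -
    have "poly p (E 1 x y) = poly (p - smult c q) (E 1 x y) + c * E n x y" by (simp add: q(2))
    also have "\<dots> = (\<Sum>j<Suc n. (\<beta>(n := c)) j * E j x y)" unfolding \<beta> by simp
    finally show ?thesis .
  qed
  then show ?case by blast
qed

lemma krein_sum_1_eq_0_if_less:
  assumes "i + 1 < j" "j \<le> D"
  shows "krein_sum 1 i j = 0"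
proof -
  have "i \<le> D" using assms by simp
  then obtain p where p: "degree p = i" "\<And>x y. E i x y = poly p (E 1 x y)"
    using E_polynomial by metis
  have "coeff (pCons 0 p) k = 0" if "i + 2 \<le> k" for k
    using that p(1) by (cases k) (auto simp: coeff_eq_0)
  then obtain \<beta> where "\<And>y z. poly (pCons 0 p) (E 1 y z) = (\<Sum>k<i + 2. \<beta> k * E k y z)"
    using poly_E1_expansion[of "i + 2" "pCons 0 p"] assms by auto
  then have \<beta>: "E 1 y z * E i y z = (\<Sum>k<i + 2. \<beta> k * E k y z)" for y z
    by (simp add: p(2))
  have "(\<Sum>z\<in>UNIV. E 1 y z * E i y z * E j y z) = 0" for y
  proof -
    have "(\<Sum>z\<in>UNIV. E 1 y z * E i y z * E j y z) = cinner (\<lambda>z. \<Sum>k<i + 2. \<beta> k * E k y z) (E j y)"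
      unfolding \<beta> cinner_def E_real[OF \<open>j \<le> D\<close>] ..
    also have "\<dots> = (\<Sum>k<i + 2. \<beta> k * cinner (E k y) (E j y))"
      by (simp only: cinner_sum_left cinner_scale_left)
    also have "\<dots> = 0" using assms by (intro sum.neutral) (simp add: cinner_E_rows)
    finally show ?thesis .
  qed
  then show ?thesis by (simp add: krein_sum_def)
qed

lemma E_dual_tridiagonal:
  assumes "i \<le> D" "j \<le> D" "i + 1 < j \<or> j + 1 < i"
  shows "mvec (E i) (\<lambda>y. E 1 x y * mvec (E j) v y) = zvec"
proof -
  have "krein_sum 1 i j = 0"
    using assms krein_sum_1_eq_0_if_less krein_sum_commute[of 1 i j] by metis
  then have "mmult (E i) (mmult (diag_mat (E 1 x)) (E j)) = zmat"
    using assms D_pos by (intro krein_sum_eq_0_imp_triple_product_eq_0)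
  then have "mvec (mmult (E i) (mmult (diag_mat (E 1 x)) (E j))) v = zvec"
    by (simp add: mvec_def zmat_def zvec_def)
  then show ?thesis by (simp only: mvec_mmult mvec_diag_mat)
qed

end

subsection \<open>Terwilliger modules\<close>

context association_scheme
begin

definition sphere_part :: "'x \<Rightarrow> nat \<Rightarrow> 'x cvec \<Rightarrow> 'x cvec" where
  "sphere_part x a w = (\<lambda>y. if idx x y = a then w y else 0)"

lemma mvec_estar: "a \<le> D \<Longrightarrow> mvec (estar R a x) w = sphere_part x a w"
proof -
  assume "a \<le> D"
  have "estar R a x = diag_mat (adj (R a) x)" by (simp add: estar_def diag_mat_def)
  then show ?thesis using \<open>a \<le> D\<close> by (auto simp: mvec_diag_mat sphere_part_def adj_R)
qed

lemma sphere_part_sphere_part: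
  "sphere_part x a (sphere_part x b w) = (if a = b then sphere_part x b w else zvec)"
  by (auto simp: sphere_part_def zvec_def)

lemma sum_sphere_part: "(\<Sum>a\<le>D. sphere_part x a w y) = w y"
  by (simp add: sphere_part_def idx_le)

lemma cinner_eq_sum_sphere_part: "cinner u w = (\<Sum>a\<le>D. cinner u (sphere_part x a w))"
  by (simp add: cinner_sum_right[symmetric] sum_sphere_part)

lemma cinner_sphere_part_commute: "cinner (sphere_part x a u) w = cinner u (sphere_part x a w)"
  by (auto simp: cinner_def sphere_part_def intro: sum.cong)

lemma endpoint_le:
  assumes "w \<in> W" "sphere_part x a w \<noteq> zvec"
  shows "endpoint D R x W \<le> a"
proof -
  have "a \<le> D"
  proof (rule ccontr)
    assume "\<not> a \<le> D"
    then have "idx x y \<noteq> a" for y using idx_le[of x y] by auto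
    then have "sphere_part x a w = zvec" by (simp add: sphere_part_def zvec_def)
    with assms show False by blast
  qed
  then show ?thesis
    unfolding endpoint_def using assms by (intro Least_le) (auto simp: mvec_estar)
qed

lemma endpoint_attained:
  assumes "w \<in> W" "w \<noteq> zvec"
  shows "\<exists>v\<in>W. sphere_part x (endpoint D R x W) v \<noteq> zvec"
proof -
  let ?P = "\<lambda>i. i \<le> D \<and> (\<exists>w\<in>W. mvec (estar R i x) w \<noteq> zvec)"
  obtain y where "w y \<noteq> 0" using assms(2) by (auto simp: zvec_def)
  then have "sphere_part x (idx x y) w y \<noteq> zvec y" by (simp add: sphere_part_def zvec_def)
  then have "sphere_part x (idx x y) w \<noteq> zvec" by auto
  then have "?P (idx x y)" using assms(1) idx_le by (auto simp: mvec_estar)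
  then have "?P (endpoint D R x W)" unfolding endpoint_def by (rule LeastI)
  then show ?thesis using mvec_estar by metis
qed

lemma endpoint_pos_if_perp_primary:
  assumes "W \<subseteq> perp (primary x)" "w \<in> W" "w \<noteq> zvec"
  shows "1 \<le> endpoint D R x W"
proof (rule ccontr)
  assume "\<not> 1 \<le> endpoint D R x W"
  then have "endpoint D R x W = 0" by simp
  then obtain v where "v \<in> W" "sphere_part x 0 v \<noteq> zvec"
    using endpoint_attained[OF assms(2,3), of x] by auto
  moreover from \<open>v \<in> W\<close> have "v x = 0"
    using perpD[of v "primary x" "hat x"] assms(1) hat_in_primary by (auto simp: cinner_hat_right)
  ultimately show False by (auto simp: sphere_part_def zvec_def idx_eq_0_iff)
qed

definition primary_part :: "'x \<Rightarrow> 'x cvec \<Rightarrow> 'x cvec" where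
  "primary_part x v = (\<lambda>y. (\<Sum>z\<in>sphere x (idx x y). v z) / of_nat (valency (idx x y)))"

lemma primary_part_in_primary: "primary_part x v \<in> primary x"
  unfolding primary_part_def by (rule primaryI)

lemma minus_primary_part_in_perp: "(\<lambda>y. v y - primary_part x v y) \<in> perp (primary x)"
proof (rule perpI)
  fix p assume "p \<in> primary x"
  then obtain f where p: "p = (\<lambda>y. f (idx x y))" by (rule primaryE)
  let ?u = "\<lambda>y. v y - primary_part x v y"
  have sphere_sum_0: "(\<Sum>y\<in>sphere x i. ?u y) = 0" if i: "i \<le> D" for i
  proof -
    obtain y where "idx x y = i" using ex_idx[OF i] by blast
    then have "valency i \<noteq> 0" by (auto simp flip: card_sphere[of x])
    moreover have "(\<Sum>y\<in>sphere x i. primary_part x v y)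
      = (\<Sum>y\<in>sphere x i. (\<Sum>z\<in>sphere x i. v z) / of_nat (valency i))"
      by (rule sum.cong) (auto simp: primary_part_def)
    ultimately show ?thesis by (simp add: sum_subtractf card_sphere)
  qed
  have "cinner ?u p = (\<Sum>i\<le>D. \<Sum>y | y \<in> UNIV \<and> idx x y = i. ?u y * cnj (f (idx x y)))"
    unfolding cinner_def p by (rule sum.group[symmetric]) (auto simp: idx_le)
  also have "\<dots> = (\<Sum>i\<le>D. (\<Sum>y\<in>sphere x i. ?u y) * cnj (f i))"
    unfolding sum_distrib_right by (intro sum.cong) auto
  also have "\<dots> = 0" using sphere_sum_0 by simp
  finally show "cinner ?u p = 0" .
qed

end

lemma tmodule_bose_mesner: "tmodule D R E x W \<Longrightarrow> B \<in> bose_mesner D R \<Longrightarrow> w \<in> W \<Longrightarrow> mvec B w \<in> W"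
  unfolding tmodule_def by (blast intro: talg.bm)

lemma tmodule_imp_csubspace: "tmodule D R E x W \<Longrightarrow> csubspace W"
  by (simp add: tmodule_def)

lemma tmodule_Inter:
  assumes "\<And>W. W \<in> \<W> \<Longrightarrow> tmodule D R E x W"
  shows "tmodule D R E x (\<Inter>\<W>)"
  using assms by (auto simp: tmodule_def csubspace_def)

lemma exists_irreducible_submodule:
  assumes "tmodule D R E x U" "v \<in> U" "v \<noteq> zvec"
  shows "\<exists>W\<subseteq>U. irreducible_tmodule D R E x W"
proof -
  let ?P = "\<lambda>W. tmodule D R E x W \<and> W \<noteq> {zvec} \<and> W \<subseteq> U"
  obtain W where W: "?P W" and minimal: "\<And>W'. ?P W' \<Longrightarrow> cvec.dim W \<le> cvec.dim W'"
    using ex_has_least_nat[of ?P U cvec.dim] assms by blast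
  have "U' = {zvec} \<or> U' = W" if "tmodule D R E x U'" "U' \<subseteq> W" for U'
  proof (cases "U' = {zvec}")
    case False
    with that W minimal have "cvec.dim W \<le> cvec.dim U'" by blast
    moreover have "cvec.subspace U'" "cvec.subspace W"
      using that W by (auto intro: csubspace_imp_subspace tmodule_imp_csubspace)
    ultimately show ?thesis using \<open>U' \<subseteq> W\<close> cvec.subspace_dim_equal by blast
  qed simp
  with W show ?thesis unfolding irreducible_tmodule_def by blast
qed

lemma irreducible_tmodule_nonzero:
  assumes "irreducible_tmodule D R E x W"
  obtains w where "w \<in> W" "w \<noteq> zvec"
  using assms csubspace_zvec[of W] unfolding irreducible_tmodule_def tmodule_def by blast

context association_scheme_idempotents
begin

lemma mvec_astar: "mvec (astar E j x) w = (\<lambda>y. of_nat (card (UNIV :: 'x set)) * E j x y * w y)"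
proof -
  have "astar E j x = diag_mat (\<lambda>y. of_nat (card (UNIV :: 'x set)) * E j x y)"
    by (simp add: astar_def diag_mat_def)
  then show ?thesis by (simp add: mvec_diag_mat)
qed

lemma tmoduleI:
  assumes S: "csubspace S"
    and M: "\<And>B w. B \<in> M \<Longrightarrow> w \<in> S \<Longrightarrow> mvec B w \<in> S"
    and diag: "\<And>j w. j \<le> D \<Longrightarrow> w \<in> S \<Longrightarrow> (\<lambda>y. E j x y * w y) \<in> S"
  shows "tmodule D R E x S"
proof -
  have "mvec B w \<in> S" if "B \<in> talg D R E x" "w \<in> S" for B w
    using that
  proof (induction B arbitrary: w)
    case (bm B)
    then show ?case by (rule M)
  next
    case (dual j)
    then show ?case using csubspace_scale[OF S diag] by (simp add: mvec_astar mult.assoc)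
  next
    case (add B C)
    then show ?case by (simp add: mvec_add csubspace_add[OF S])
  next
    case (smult B c)
    then show ?case by (simp add: mvec_scale csubspace_scale[OF S])
  next
    case (mult B C)
    then show ?case by (simp add: mvec_mmult)
  qed
  with S show ?thesis by (simp add: tmodule_def)
qed

lemma tmodule_diag:
  assumes W: "tmodule D R E x W" and w: "w \<in> W"
  shows "(\<lambda>y. c (idx x y) * w y) \<in> W"
proof -
  let ?n = "of_nat (card (UNIV :: 'x set)) :: complex"
  obtain \<beta> where "(\<lambda>x y. c (idx x y)) = (\<lambda>x y. \<Sum>j\<le>D. \<beta> j * E j x y)"
    by (rule bose_mesner_E_expansion[OF bose_mesnerI[of c]])
  then have "c (idx x y) = (\<Sum>j\<le>D. \<beta> j * E j x y)" for y by (auto dest: fun_cong)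
  then have "(\<lambda>y. c (idx x y) * w y) = (\<lambda>y. \<Sum>j\<le>D. \<beta> j / ?n * mvec (astar E j x) w y)"
    by (simp add: mvec_astar sum_distrib_right mult.assoc)
  also have "\<dots> \<in> W"
    using W w by (intro csubspace_sum csubspace_scale) (auto simp: tmodule_def intro: talg.dual)
  finally show ?thesis .
qed

lemma tmodule_hadamard_row:
  assumes "tmodule D R E x W" "w \<in> W" "B \<in> M"
  shows "(\<lambda>y. B x y * w y) \<in> W"
  using assms(3) by (rule bose_mesnerE) (simp add: tmodule_diag[OF assms(1,2)])

lemma tmodule_sphere_part: "tmodule D R E x W \<Longrightarrow> w \<in> W \<Longrightarrow> sphere_part x a w \<in> W"
  using tmodule_diag[of x W w "\<lambda>k. if k = a then 1 else 0"]
  by (simp add: sphere_part_def if_distrib[of "\<lambda>c. c * _"] cong: if_cong)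

lemma tmodule_primary: "tmodule D R E x (primary x)"
proof (rule tmoduleI)
  show "csubspace (primary x)"
    unfolding csubspace_def
  proof (intro conjI ballI allI)
    show "zvec \<in> primary x" unfolding zvec_def by (rule primaryI)
  next
    fix u v assume "u \<in> primary x" "v \<in> primary x"
    then obtain f g where "u = (\<lambda>y. f (idx x y))" "v = (\<lambda>y. g (idx x y))" by (elim primaryE)
    then show "(\<lambda>y. u y + v y) \<in> primary x" by (simp only: primaryI[of "\<lambda>k. f k + g k"])
  next
    fix c u assume "u \<in> primary x"
    then obtain f where "u = (\<lambda>y. f (idx x y))" by (elim primaryE)
    then show "(\<lambda>y. c * u y) \<in> primary x" by (simp only: primaryI[of "\<lambda>k. c * f k"])
  qed
  show "mvec B w \<in> primary x" if "B \<in> M" "w \<in> primary x" for B w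
    using that by (auto simp: primary_def bose_mesner_mmult simp flip: mvec_mmult)
  fix j w assume j: "j \<le> D" and "w \<in> primary x"
  from \<open>w \<in> primary x\<close> obtain f where f: "w = (\<lambda>y. f (idx x y))" by (rule primaryE)
  from E_in_bose_mesner[OF j] obtain e where "E j = (\<lambda>x y. e (idx x y))" by (rule bose_mesnerE)
  with f show "(\<lambda>y. E j x y * w y) \<in> primary x" by (simp only: primaryI[of "\<lambda>k. e k * f k"])
qed

lemma tmodule_perp:
  assumes W: "tmodule D R E x W"
  shows "tmodule D R E x (perp W)"
proof (rule tmoduleI[OF csubspace_perp])
  fix B v assume B: "B \<in> M" and v: "v \<in> perp W"
  have "cadjoint B \<in> M" using B by (simp add: bose_mesner_cadjoint bose_mesner_cnj)
  then show "mvec B v \<in> perp W"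
    using v by (auto intro!: perpI simp: cinner_mvec_cadjoint dest: perpD tmodule_bose_mesner[OF W])
next
  fix j v assume j: "j \<le> D" and v: "v \<in> perp W"
  then show "(\<lambda>y. E j x y * v y) \<in> perp W"
    using tmodule_hadamard_row[OF W _ E_in_bose_mesner[OF j]]
    by (simp add: perp_def cinner_mult_left E_real[OF j])
qed

lemma exists_irreducible_not_orthogonal:
  assumes P: "tmodule D R E x P" and v: "v \<in> perp P" "v \<noteq> zvec"
  shows "\<exists>W. irreducible_tmodule D R E x W \<and> W \<subseteq> perp P \<and> v \<notin> perp W"
proof -
  define U where "U = \<Inter>{S. tmodule D R E x S \<and> v \<in> S}"
  have U_subset: "U \<subseteq> S" if "tmodule D R E x S" "v \<in> S" for S
    using that by (auto simp: U_def)
  have "tmodule D R E x U" unfolding U_def by (rule tmodule_Inter) blast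
  moreover have "v \<in> U" by (auto simp: U_def)
  ultimately obtain W where W: "W \<subseteq> U" "irreducible_tmodule D R E x W"
    using exists_irreducible_submodule v(2) by metis
  have "v \<notin> perp W"
  proof
    assume "v \<in> perp W"
    moreover have "tmodule D R E x W" using W(2) by (simp add: irreducible_tmodule_def)
    ultimately have "W \<subseteq> perp W" using U_subset[OF tmodule_perp] W(1) by blast
    then have "w = zvec" if "w \<in> W" for w
      using that perpD by (auto simp flip: cinner_self_eq_0_iff)
    then show False using irreducible_tmodule_nonzero[OF W(2)] by blast
  qed
  with W U_subset[OF tmodule_perp[OF P] v(1)] show ?thesis by blast
qed

lemma in_primary_if_orthogonal_to_irreducibles:
  assumes orthogonal: "\<And>W. irreducible_tmodule D R E x W \<Longrightarrow> W \<subseteq> perp (primary x) \<Longrightarrow> v \<in> perp W"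
  shows "v \<in> primary x"
proof (rule ccontr)
  let ?p = "primary_part x v"
  let ?u = "\<lambda>y. v y - ?p y"
  assume "v \<notin> primary x"
  then have "v \<noteq> ?p" using primary_part_in_primary by metis
  then have "?u \<noteq> zvec" by (auto simp: zvec_def fun_eq_iff)
  then obtain W where W: "irreducible_tmodule D R E x W" "W \<subseteq> perp (primary x)" "?u \<notin> perp W"
    using exists_irreducible_not_orthogonal[OF tmodule_primary minus_primary_part_in_perp] by blast
  have "cinner ?u w = 0" if "w \<in> W" for w
  proof -
    have "cinner ?p w = 0"
      using that W(2) primary_part_in_primary by (subst cinner_eq_0_commute) (auto dest: perpD)
    moreover have "cinner v w = 0" using perpD[OF orthogonal[OF W(1,2)] that] .
    ultimately show ?thesis by (simp add: cinner_diff_left)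
  qed
  with W(3) show False by (blast intro: perpI)
qed

lemma cinner_mvec_E: "j \<le> D \<Longrightarrow> cinner (mvec (E j) u) v = cinner u (mvec (E j) v)"
  by (simp add: cinner_mvec_cadjoint cadjoint_E)

lemma cinner_eq_sum_mvec_E: "cinner u w = (\<Sum>j\<le>D. cinner u (mvec (E j) w))"
  by (simp add: cinner_sum_right[symmetric] sum_mvec_E)

lemma dual_endpoint_attained:
  assumes "w \<in> W" "w \<noteq> zvec"
  shows "dual_endpoint D E W \<le> D"
    and "\<exists>v\<in>W. mvec (E (dual_endpoint D E W)) v \<noteq> zvec"
proof -
  let ?P = "\<lambda>j. j \<le> D \<and> (\<exists>w\<in>W. mvec (E j) w \<noteq> zvec)"
  obtain y where "w y \<noteq> 0" using assms(2) by (auto simp: zvec_def)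
  then have "(\<Sum>j\<le>D. mvec (E j) w y) \<noteq> 0" by (simp add: sum_mvec_E)
  then obtain j where "j \<le> D" "mvec (E j) w y \<noteq> 0" by (meson atMost_iff sum.neutral)
  then have "?P j" using assms(1) by (metis zvec_def)
  then have "?P (dual_endpoint D E W)"
    unfolding dual_endpoint_def by (rule LeastI)
  then show "dual_endpoint D E W \<le> D" "\<exists>v\<in>W. mvec (E (dual_endpoint D E W)) v \<noteq> zvec" by blast+
qed

lemma mvec_E_relative_design_in_primary:
  assumes "relative_design E t x \<psi>" "j \<le> t" "t \<le> D"
  shows "mvec (E j) \<psi> \<in> primary x"
proof (cases "j = 0")
  case True
  then have "mvec (E j) \<psi> = (\<lambda>y. \<Sum>z\<in>UNIV. 1 / of_nat (card (UNIV :: 'x set)) * \<psi> z)"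
    using idempotents by (simp add: primitive_idempotents_def mvec_def)
  then show ?thesis by (simp only: primaryI[of "\<lambda>_. _"])
next
  case False
  have j: "j \<le> D" using assms by simp
  have "lin_dep2 (mvec (E j) \<psi>) (mvec (E j) (hat x))"
    using assms False by (simp add: relative_design_def)
  then obtain a b where ab: "(a, b) \<noteq> (0, 0)"
    and "(\<lambda>y. a * mvec (E j) \<psi> y + b * mvec (E j) (hat x) y) = zvec"
    unfolding lin_dep2_def by blast
  then have dependent: "a * mvec (E j) \<psi> y + b * E j x y = 0" for y
    unfolding E_sym[OF j, of x y] by (simp add: mvec_hat zvec_def fun_eq_iff)
  have "a \<noteq> 0" using ab dependent[of x] E_diag_nonzero[OF j, of x] by auto
  then have "mvec (E j) \<psi> = (\<lambda>y. - b / a * E j x y)"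
    using dependent by (intro ext) (simp add: field_simps eq_neg_iff_add_eq_0)
  moreover from E_in_bose_mesner[OF j] obtain e where "E j = (\<lambda>x y. e (idx x y))"
    by (rule bose_mesnerE)
  ultimately show ?thesis by (simp only: primaryI[of "\<lambda>k. - b / a * e k"])
qed

lemma cinner_relative_design_mvec_E:
  assumes "relative_design E t x \<psi>" "j \<le> t" "t \<le> D" "w \<in> perp (primary x)"
  shows "cinner \<psi> (mvec (E j) w) = 0"
proof -
  have "cinner \<psi> (mvec (E j) w) = cinner (mvec (E j) \<psi>) w" using assms by (simp add: cinner_mvec_E)
  also have "\<dots> = 0"
    using perpD[OF assms(4) mvec_E_relative_design_in_primary[OF assms(1-3)]]
    by (simp add: cinner_eq_0_commute)
  finally show ?thesis .
qed

end

subsection \<open>Cycles\<close>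

lemma ex_nonbacktracking_walk:
  fixes G :: "('x \<times> 'x) set"
  assumes "sym G" and degree_2: "\<And>v. card (G `` {v}) = 2"
  obtains f :: "nat \<Rightarrow> 'x" where "\<And>m. G `` {f (Suc m)} = {f m, f (Suc (Suc m))}"
    and "\<And>m. f (Suc (Suc m)) \<noteq> f m"
proof -
  define step where "step = (\<lambda>(u, v) (u', v'). u' = v \<and> v' \<noteq> u \<and> G `` {v} = {u, v'})"
  have "\<exists>g. \<forall>m. g m \<in> G \<and> step (g m) (g (Suc m))"
  proof (rule dependent_nat_choice)
    have "G `` {undefined} \<noteq> {}" using degree_2[of undefined] by auto
    then show "\<exists>e. e \<in> G" by blast
    fix e :: "'x \<times> 'x" and m :: nat assume "e \<in> G"
    then obtain u v where uv: "e = (u, v)" "u \<in> G `` {v}"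
      using \<open>sym G\<close> by (cases e) (auto dest: symD)
    obtain p q where "G `` {v} = {p, q}" "p \<noteq> q" using degree_2[of v] by (auto simp: card_2_iff)
    with uv(2) obtain w where w: "G `` {v} = {u, w}" "w \<noteq> u"
      by (metis insertE insert_commute singletonD)
    then have "(v, w) \<in> G" by blast
    with w uv(1) show "\<exists>e'. e' \<in> G \<and> step e e'" by (auto simp: step_def)
  qed
  then obtain g where "step (g m) (g (Suc m))" for m by blast
  then have "snd (g m) = fst (g (Suc m)) \<and> snd (g (Suc m)) \<noteq> fst (g m)
      \<and> G `` {snd (g m)} = {fst (g m), snd (g (Suc m))}" for m
    by (metis (mono_tags, lifting) step_def case_prod_beta)
  then show ?thesis by (intro that[of "\<lambda>m. fst (g m)"]) metis+
qed

locale nonbacktracking_walk =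
  fixes G :: "('x::finite \<times> 'x) set" and f :: "nat \<Rightarrow> 'x"
  assumes sym: "sym G" and irrefl: "irrefl G"
    and neighbours: "G `` {f (Suc m)} = {f m, f (Suc (Suc m))}"
    and nonbacktracking: "f (Suc (Suc m)) \<noteq> f m"
begin

lemma edge: "(f m, f (Suc m)) \<in> G"
  using neighbours[of m] sym by (auto dest: symD)

lemma f_Suc_neq: "f (Suc m) \<noteq> f m"
  using edge[of m] irrefl by (auto simp: irrefl_def)

lemma first_repetition_is_return:
  assumes inj: "inj_on f {..<n}" and j: "j < n" "f j = f n"
  shows "j = 0"
proof (rule ccontr)
  assume "j \<noteq> 0"
  then obtain i where i: "j = Suc i" by (cases j) auto
  obtain l where l: "n = Suc l" using j by (cases n) auto
  have "f l \<in> G `` {f j}" using neighbours[of l] j l by auto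
  then have "f l = f i \<or> f l = f (Suc j)" unfolding i neighbours by blast
  moreover have "l \<noteq> i" "Suc j < n \<or> Suc j = n" using i j l by auto
  moreover have "f l = f k \<Longrightarrow> k < n \<Longrightarrow> l = k" for k using inj l by (simp add: inj_on_def)
  ultimately have "Suc j = n \<or> l = Suc j" using i j by auto
  then show False using f_Suc_neq[of j] nonbacktracking[of j] j l by auto
qed

lemma ex_first_return: "\<exists>n\<ge>3. inj_on f {..<n} \<and> f n = f 0"
proof -
  define n where "n = (LEAST n. \<exists>j<n. f j = f n)"
  have "\<not> inj f" using finite_imageD[of f UNIV] by (metis finite infinite_UNIV_nat)
  then have "\<exists>n. \<exists>j<n. f j = f n" by (metis injI linorder_neqE_nat)
  then have "\<exists>j<n. f j = f n" unfolding n_def by (rule LeastI_ex)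
  then obtain j where j: "j < n" "f j = f n" by blast
  have inj: "inj_on f {..<n}"
  proof (rule linorder_inj_onI)
    fix i k assume "i < k" "k \<in> {..<n}"
    then show "f i \<noteq> f k" unfolding n_def by (auto dest: not_less_Least)
  qed auto
  have "j = 0" using inj j by (rule first_repetition_is_return)
  moreover have "n \<noteq> 1" "n \<noteq> 2"
    using calculation j f_Suc_neq[of 0] nonbacktracking[of 0] by (auto simp: numeral_2_eq_2)
  ultimately show ?thesis using j inj by (intro exI[of _ n]) auto
qed

lemma periodic_if_return:
  assumes "3 \<le> n" "inj_on f {..<n}" "f n = f 0"
  shows "f (m + n) = f m"
proof -
  have "f (m + n) = f m \<and> f (Suc m + n) = f (Suc m)" for m
  proof (induction m)
    case 0
    obtain l where l: "n = Suc l" using assms(1) by (cases n) auto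
    have "f 1 \<in> {f l, f (Suc n)}" using edge[of 0] neighbours[of l] assms(3) l by auto
    moreover have "f 1 \<noteq> f l" using inj_onD[OF assms(2), of 1 l] assms(1) l by auto
    ultimately show ?case using assms(3) by auto
  next
    case (Suc m)
    then have "{f m, f (Suc (Suc (m + n)))} = {f m, f (Suc (Suc m))}"
      using neighbours[of m] neighbours[of "m + n"] by simp
    then show ?case using Suc nonbacktracking[of m] by (auto simp: doubleton_eq_iff)
  qed
  then show ?thesis by blast
qed

lemma adjacent_iff_if_return:
  assumes n: "3 \<le> n" and inj: "inj_on f {..<n}" and return: "f n = f 0" and less: "i < n" "j < n"
  shows "(f i, f j) \<in> G \<longleftrightarrow> j = (i + 1) mod n \<or> i = (j + 1) mod n"
proof -
  note periodic = periodic_if_return[OF n inj return]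
  have f_mod: "f (m mod n) = f m" for m
  proof -
    have "f (k + l * n) = f k" for k l
    proof (induction l)
      case (Suc l)
      then show ?case using periodic[of "k + l * n"] by (simp add: algebra_simps)
    qed simp
    from this[of "m mod n" "m div n"] show ?thesis by simp
  qed
  have f_eq_iff: "f k = f l \<longleftrightarrow> k mod n = l mod n" for k l
  proof -
    have "f (k mod n) = f (l mod n) \<longleftrightarrow> k mod n = l mod n" using inj n by (auto simp: inj_on_def)
    then show ?thesis by (simp only: f_mod)
  qed
  define i' where "i' = i + n - 1"
  have i': "Suc i' = i + n" using n by (simp add: i'_def)
  have "(f i, f j) \<in> G \<longleftrightarrow> f j \<in> G `` {f (Suc i')}" by (simp add: i' periodic)
  also have "\<dots> \<longleftrightarrow> j mod n = i' mod n \<or> j mod n = Suc (Suc i') mod n"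
    by (simp add: neighbours f_eq_iff)
  also have "j mod n = i' mod n \<longleftrightarrow> Suc j mod n = Suc i' mod n"
    by (metis mod_Suc nat.inject nat.distinct(1))
  also have "Suc i' mod n = i" using i' less by simp
  also have "Suc (Suc i') mod n = Suc i mod n" by (metis add_Suc i' mod_add_self2)
  finally show ?thesis using less by auto
qed

lemma image_eq_UNIV_if_return:
  assumes n: "3 \<le> n" and inj: "inj_on f {..<n}" and return: "f n = f 0"
    and connected: "\<And>v. (f 0, v) \<in> G\<^sup>*"
  shows "f ` {..<n} = UNIV"
proof -
  have "v \<in> f ` {..<n}" for v
    using connected[of v]
  proof (induction rule: rtrancl_induct)
    case base
    then show ?case using n by auto
  next
    case (step v w)
    then obtain i where i: "i < n" "v = f i" by blast
    then have "v = f (Suc (i + n - 1))" using periodic_if_return[OF n inj return, of i] n by simp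
    then have "w \<in> {f (i + n - 1), f (Suc (i + n))}"
      using \<open>(v, w) \<in> G\<close> neighbours[of "i + n - 1"] n by auto
    moreover have "f (i + n - 1) \<in> f ` {..<n}"
    proof (cases i)
      case 0
      then show ?thesis using n by simp
    next
      case (Suc l)
      then show ?thesis using periodic_if_return[OF n inj return, of l] i by auto
    qed
    moreover have "f (Suc (i + n)) \<in> f ` {..<n}"
      using periodic_if_return[OF n inj return, of "Suc i"] return i n by (cases "Suc i = n") auto
    ultimately show ?case by blast
  qed
  then show ?thesis by blast
qed

end

theorem connected_2_regular_imp_cycle_graph:
  fixes G :: "('x::finite \<times> 'x) set"
  assumes "sym G" "irrefl G" and degree_2: "\<And>v. card (G `` {v}) = 2"
    and connected: "\<And>u v. (u, v) \<in> G\<^sup>*"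
  shows "is_cycle_graph G"
proof -
  obtain f where "\<And>m. G `` {f (Suc m)} = {f m, f (Suc (Suc m))}" "\<And>m. f (Suc (Suc m)) \<noteq> f m"
    using ex_nonbacktracking_walk[OF \<open>sym G\<close> degree_2] by blast
  with \<open>sym G\<close> \<open>irrefl G\<close> interpret nonbacktracking_walk G f by (simp add: nonbacktracking_walk_def)
  obtain n where n: "3 \<le> n" "inj_on f {..<n}" "f n = f 0" using ex_first_return by blast
  then have "bij_betw f {..<n} UNIV"
    using image_eq_UNIV_if_return[OF n connected] by (simp add: bij_betw_def)
  with n adjacent_iff_if_return[OF n] show ?thesis unfolding is_cycle_graph_def by blast
qed

subsection \<open>Distances in metric schemes\<close>

locale metric_association_scheme = association_scheme D R
  for D and R :: "nat \<Rightarrow> ('x::finite \<times> 'x) set" +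
  assumes metric: "metric_scheme D R"
begin

abbreviation dst :: "'x \<Rightarrow> 'x \<Rightarrow> nat" where "dst \<equiv> idx"

lemma in_relpow_dst: "(x, y) \<in> R 1 ^^ dst x y"
  using metric idx_le in_R_idx unfolding metric_scheme_def by blast

lemma dst_le_if_in_relpow: "(x, y) \<in> R 1 ^^ m \<Longrightarrow> dst x y \<le> m"
  using metric idx_le in_R_idx unfolding metric_scheme_def by (meson not_le)

lemma dst_triangle: "dst x z \<le> dst x y + dst y z"
proof -
  have "(x, z) \<in> R 1 ^^ (dst x y + dst y z)"
    using in_relpow_dst[of x y] in_relpow_dst[of y z] by (auto simp: relpow_add)
  then show ?thesis by (rule dst_le_if_in_relpow)
qed

lemma dst_intermediate:
  assumes "dst x y = a + b"
  obtains z where "dst x z = a" "dst z y = b"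
proof -
  have "(x, y) \<in> R 1 ^^ a O R 1 ^^ b"
    using in_relpow_dst[of x y] assms by (simp add: relpow_add)
  then obtain z where "(x, z) \<in> R 1 ^^ a" "(z, y) \<in> R 1 ^^ b" by blast
  then have "dst x z \<le> a" "dst z y \<le> b" by (auto intro: dst_le_if_in_relpow)
  with dst_triangle[of x y z] assms have "dst x z = a" "dst z y = b" by linarith+
  then show ?thesis by (rule that)
qed

lemma connected: "(x, y) \<in> (R 1)\<^sup>*"
  using in_relpow_dst by (rule relpow_imp_rtrancl)

lemma UNIV_if_closed_under_adjacency:
  assumes "x \<in> S" "\<And>y. y \<in> S \<Longrightarrow> sphere y 1 \<subseteq> S"
  shows "S = UNIV"
proof -
  have "y \<in> S" for y
    using connected[of x y]
  proof (induction rule: rtrancl_induct)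
    case (step y z)
    then show ?case using assms(2) D_pos by (auto simp: sphere_eq_Image)
  qed (rule assms(1))
  then show ?thesis by blast
qed

lemma valency_1_ge_2:
  assumes "2 \<le> D"
  shows "2 \<le> valency 1"
proof -
  fix x :: 'x
  obtain y where y: "dst x y = 2" using ex_idx[OF assms] by blast
  then obtain z where "dst x z = 1" "dst z y = 1" using dst_intermediate[of x y 1 1] by auto
  then have "card {x, y} \<le> card (sphere z 1)" by (intro card_mono) (auto simp: idx_commute)
  moreover have "x \<noteq> y" using y by auto
  ultimately show ?thesis by (simp add: card_sphere)
qed

lemma valency_1_eq_2_imp_cycle_graph:
  assumes "valency 1 = 2"
  shows "is_cycle_graph (R 1)"
proof (rule connected_2_regular_imp_cycle_graph)
  show "sym (R 1)" using scheme D_pos by (simp add: assoc_scheme_def)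
  show "irrefl (R 1)" using D_pos by (auto simp: irrefl_def in_R_iff)
  show "card (R 1 `` {v}) = 2" for v
    using assms D_pos card_sphere[of v 1] by (simp add: sphere_eq_Image)
qed (rule connected)

text \<open>In standard notation, \<open>intersection_number\<close> at \<open>(i - 1, 1, i)\<close>, \<open>(i, 1, i)\<close> and
  \<open>(i + 1, 1, i)\<close> is \<open>c\<^sub>i\<close>, \<open>a\<^sub>i\<close> and \<open>b\<^sub>i\<close>.\<close>

lemma valency_1_eq_c_plus_a_plus_b:
  assumes "Suc i \<le> D"
  shows "valency 1 = intersection_number i 1 (Suc i) + intersection_number (Suc i) 1 (Suc i)
    + intersection_number (Suc (Suc i)) 1 (Suc i)"
proof -
  fix x :: 'x
  obtain y where y: "dst x y = Suc i" using ex_idx[OF assms] by blast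
  let ?N = "\<lambda>k. sphere x k \<inter> sphere y 1"
  have "sphere y 1 \<subseteq> ?N i \<union> ?N (Suc i) \<union> ?N (Suc (Suc i))"
  proof
    fix z assume "z \<in> sphere y 1"
    then have z: "dst y z = 1" by simp
    then have "dst x z = i \<or> dst x z = Suc i \<or> dst x z = Suc (Suc i)"
      using dst_triangle[of x z y] dst_triangle[of x y z] y idx_commute[of y z] by linarith
    with z show "z \<in> ?N i \<union> ?N (Suc i) \<union> ?N (Suc (Suc i))" by auto
  qed
  then have "sphere y 1 = ?N i \<union> ?N (Suc i) \<union> ?N (Suc (Suc i))" by blast
  then have "card (sphere y 1) = card (?N i \<union> ?N (Suc i) \<union> ?N (Suc (Suc i)))" by simp
  also have "\<dots> = card (?N i) + card (?N (Suc i)) + card (?N (Suc (Suc i)))"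
    by (subst card_Un_disjoint; auto)+
  finally show ?thesis by (simp add: card_sphere card_sphere_Int y)
qed

lemma c_mono:
  assumes "Suc (Suc i) \<le> D"
  shows "intersection_number i 1 (Suc i) \<le> intersection_number (Suc i) 1 (Suc (Suc i))"
proof -
  fix x :: 'x
  obtain y where y: "dst x y = Suc (Suc i)" using ex_idx[OF assms] by blast
  then obtain x' where x': "dst x x' = 1" "dst x' y = Suc i"
    using dst_intermediate[of x y 1 "Suc i"] by auto
  have "sphere x' i \<inter> sphere y 1 \<subseteq> sphere x (Suc i) \<inter> sphere y 1"
  proof
    fix z assume "z \<in> sphere x' i \<inter> sphere y 1"
    then show "z \<in> sphere x (Suc i) \<inter> sphere y 1"
      using dst_triangle[of x z x'] dst_triangle[of x y z] x' y idx_commute[of y z] by auto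
  qed
  then have "card (sphere x' i \<inter> sphere y 1) \<le> card (sphere x (Suc i) \<inter> sphere y 1)"
    by (intro card_mono) simp
  then show ?thesis by (simp add: card_sphere_Int x' y)
qed

lemma b_antimono:
  assumes "Suc i \<le> D"
  shows "intersection_number (Suc (Suc i)) 1 (Suc i) \<le> intersection_number (Suc i) 1 i"
proof -
  fix x :: 'x
  obtain y where y: "dst x y = Suc i" using ex_idx[OF assms] by blast
  then obtain x' where x': "dst x x' = 1" "dst x' y = i"
    using dst_intermediate[of x y 1 i] by auto
  have "sphere x (Suc (Suc i)) \<inter> sphere y 1 \<subseteq> sphere x' (Suc i) \<inter> sphere y 1"
  proof
    fix z assume "z \<in> sphere x (Suc (Suc i)) \<inter> sphere y 1"
    then show "z \<in> sphere x' (Suc i) \<inter> sphere y 1"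
      using dst_triangle[of x z x'] dst_triangle[of x' z y] x' by auto
  qed
  then have "card (sphere x (Suc (Suc i)) \<inter> sphere y 1) \<le> card (sphere x' (Suc i) \<inter> sphere y 1)"
    by (intro card_mono) simp
  then show ?thesis by (simp add: card_sphere_Int x' y)
qed

text \<open>On a path \<open>x, m, p, q\<close> with \<open>q\<close> at distance 3 from \<open>x\<close>, let \<open>p, q, s\<close> be a triangle. Then
  \<open>p\<close> and \<open>s\<close> are at distance 2 from \<open>x\<close>, or \<open>q\<close> and \<open>s\<close> are at distance 2 from \<open>m\<close>.\<close>

lemma a1_eq_0_if_a2_eq_0:
  assumes "3 \<le> D" and a2: "intersection_number 2 1 2 = 0"
  shows "intersection_number 1 1 1 = 0"
proof (rule ccontr)
  assume a1: "intersection_number 1 1 1 \<noteq> 0"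
  have no_edge: "dst v w \<noteq> 1" if "dst u v = 2" "dst u w = 2" for u v w
    using sphere_Int_empty_iff[of u 2 v 1] a2 that by auto
  fix x :: 'x
  obtain q where q: "dst x q = 3" using ex_idx[OF assms(1)] by blast
  then obtain p where p: "dst x p = 2" "dst p q = 1" using dst_intermediate[of x q 2 1] by auto
  then obtain m where m: "dst x m = 1" "dst m p = 1" using dst_intermediate[of x p 1 1] by auto
  obtain s where s: "dst p s = 1" "dst q s = 1"
    using sphere_Int_empty_iff[of p 1 q 1] a1 p by auto
  have "dst x s \<noteq> 2" using no_edge[of x p s] p s by blast
  then have "dst x s = 3"
    using dst_triangle[of x q s] dst_triangle[of x s p] p s q idx_commute[of q s] by linarith
  then have "dst m s = 2" "dst m q = 2"
    using dst_triangle[of x s m] dst_triangle[of x q m]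
      dst_triangle[of m s p] dst_triangle[of m q p] m p s q by linarith+
  then show False using no_edge s by metis
qed

end

subsection \<open>Codes closed under their minimum distance\<close>

locale sphere_closed_code = metric_association_scheme D R
  for D and R :: "nat \<Rightarrow> ('x::finite \<times> 'x) set" +
  fixes Z :: "'x set" and \<delta> :: nat
  assumes \<delta>_pos: "0 < \<delta>" and \<delta>_le: "\<delta> \<le> D"
    and nonempty: "Z \<noteq> {}"
    and sphere_subset: "\<And>z. z \<in> Z \<Longrightarrow> sphere z \<delta> \<subseteq> Z"
    and \<delta>_le_dst: "\<And>y z. y \<in> Z \<Longrightarrow> z \<in> Z \<Longrightarrow> y \<noteq> z \<Longrightarrow> \<delta> \<le> dst y z"
begin

lemma UNIV_if_\<delta>_eq_1: "\<delta> = 1 \<Longrightarrow> Z = UNIV"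
  using nonempty sphere_subset UNIV_if_closed_under_adjacency[of _ Z] by blast

lemma a_\<delta>_eq_0:
  assumes "2 \<le> \<delta>"
  shows "intersection_number \<delta> 1 \<delta> = 0"
proof -
  obtain x where x: "x \<in> Z" using nonempty by blast
  obtain y where y: "dst x y = \<delta>" using ex_idx[OF \<delta>_le] by blast
  have "dst y z \<noteq> 1" if "dst x z = \<delta>" for z
    using \<delta>_le_dst[of y z] sphere_subset[OF x] that y assms by fastforce
  then have "sphere x \<delta> \<inter> sphere y 1 = {}" by auto
  with y show ?thesis by (simp add: sphere_Int_empty_iff)
qed

lemma intersection_number_\<delta>_1_le_1:
  assumes "3 \<le> \<delta>" "k \<le> D"
  shows "intersection_number \<delta> 1 k \<le> 1"
proof -
  obtain x where x: "x \<in> Z" using nonempty by blast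
  obtain u where u: "dst x u = k" using ex_idx[OF assms(2)] by blast
  have "y = z" if yz: "y \<in> sphere x \<delta> \<inter> sphere u 1" "z \<in> sphere x \<delta> \<inter> sphere u 1" for y z
  proof (rule ccontr)
    assume "y \<noteq> z"
    then have "\<delta> \<le> dst y z" using yz sphere_subset[OF x] by (intro \<delta>_le_dst) blast+
    moreover have "dst y z \<le> 2" using dst_triangle[of y z u] yz idx_commute[of y u] by auto
    ultimately show False using assms(1) by simp
  qed
  then have "card (sphere x \<delta> \<inter> sphere u 1) \<le> 1"
    by (simp only: One_nat_def card_le_Suc0_iff_eq finite) blast
  then show ?thesis by (simp add: card_sphere_Int u)
qed

lemma valency_1_eq_2:
  assumes "3 \<le> \<delta>" "\<delta> < D"
  shows "valency 1 = 2"
proof -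
  obtain i where i: "\<delta> = Suc i" using assms by (cases \<delta>) auto
  have "intersection_number i 1 \<delta> \<le> 1"
    using c_mono[of i] intersection_number_\<delta>_1_le_1[of "Suc \<delta>"] assms i by simp
  moreover have "intersection_number (Suc \<delta>) 1 \<delta> \<le> 1"
    using b_antimono[of i] intersection_number_\<delta>_1_le_1[of i] assms i by simp
  ultimately have "valency 1 \<le> 2"
    using valency_1_eq_c_plus_a_plus_b[of i] a_\<delta>_eq_0 assms i by simp
  moreover have "2 \<le> valency 1" using assms by (intro valency_1_ge_2) simp
  ultimately show ?thesis by simp
qed

lemma covering_if_\<delta>_eq_2:
  assumes "\<delta> = 2"
  shows "\<exists>z\<in>Z. dst z v \<le> 1"
proof -
  let ?S = "{v. \<exists>z\<in>Z. dst z v \<le> 1}"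
  obtain x where x: "x \<in> Z" using nonempty by blast
  have "?S = UNIV"
  proof (rule UNIV_if_closed_under_adjacency)
    show "x \<in> ?S" using x by force
    fix y assume "y \<in> ?S"
    then obtain z where z: "z \<in> Z" "dst z y \<le> 1" by blast
    show "sphere y 1 \<subseteq> ?S"
    proof
      fix w assume "w \<in> sphere y 1"
      then have "dst z w \<le> 2" using dst_triangle[of z w y] z by simp
      then consider "dst z w \<le> 1" | "w \<in> sphere z \<delta>" using assms by fastforce
      then show "w \<in> ?S"
      proof cases
        case 2
        then show ?thesis using sphere_subset[OF z(1)] by force
      qed (use z in blast)
    qed
  qed
  then show ?thesis by blast
qed

lemma bipartite_half_if_\<delta>_eq_2:
  assumes "\<delta> = 2" "3 \<le> D"
  shows "bipartite_half (R 1) Z"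
proof -
  have a1: "intersection_number 1 1 1 = 0" using a1_eq_0_if_a2_eq_0 a_\<delta>_eq_0 assms by simp
  have halves: "u \<in> Z \<longleftrightarrow> v \<notin> Z" if uv: "dst u v = 1" for u v
  proof -
    have "u \<in> Z \<or> v \<in> Z"
    proof (rule ccontr)
      assume "\<not> (u \<in> Z \<or> v \<in> Z)"
      then have notin: "u \<notin> Z" "v \<notin> Z" by auto
      obtain z where z: "z \<in> Z" "dst z u \<le> 1" using covering_if_\<delta>_eq_2[OF assms(1)] by blast
      then have "dst z u = 1"
        using notin idx_eq_0_iff[of z u] by (metis le_neq_implies_less less_one)
      moreover have "dst z v \<noteq> 0" "dst z v \<noteq> 2"
        using notin z sphere_subset[OF z(1)] assms by (auto simp: idx_eq_0_iff)
      moreover have "dst z v \<le> 2" using dst_triangle[of z v u] z uv by linarith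
      ultimately have "dst z u = 1" "z \<in> sphere u 1 \<inter> sphere v 1" by (auto simp: idx_commute)
      with a1 uv show False using sphere_Int_empty_iff[of u 1 v 1] by auto
    qed
    moreover have "\<not> (u \<in> Z \<and> v \<in> Z)" using \<delta>_le_dst[of u v] uv assms by (cases "u = v") auto
    ultimately show ?thesis by blast
  qed
  have "Z \<noteq> UNIV" using halves ex_idx[OF D_pos] by (metis UNIV_I)
  with nonempty halves D_pos show ?thesis by (auto simp: bipartite_half_def in_R_iff)
qed

lemma antipodal_if_\<delta>_eq_D:
  assumes "\<delta> = D"
  shows "equiv UNIV (Id \<union> R D)"
proof (rule equivI)
  have rel: "(u, v) \<in> Id \<union> R D \<longleftrightarrow> u = v \<or> dst u v = D" for u v by (simp add: in_R_iff)
  show "sym (Id \<union> R D)" by (rule symI, unfold rel) (metis idx_commute)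
  show "trans (Id \<union> R D)"
  proof (rule transI, unfold rel)
    fix u v w assume "u = v \<or> dst u v = D" "v = w \<or> dst v w = D"
    then consider "u = w \<or> dst u w = D" | "dst u v = D" "dst v w = D" by blast
    then show "u = w \<or> dst u w = D"
    proof cases
      case 2
      obtain x where x: "x \<in> Z" using nonempty by blast
      obtain y where y: "dst x y = dst u w" using ex_idx[OF idx_le] by blast
      have "v \<in> sphere u D \<inter> sphere w D" using 2 by (simp add: idx_commute)
      then have "sphere x D \<inter> sphere y D \<noteq> {}"
        using sphere_Int_empty_iff[of u D w D] sphere_Int_empty_iff[of x D y D] y by auto
      then obtain z where "z \<in> sphere x D" "y \<in> sphere z D" by (auto simp: idx_commute)
      then have "y \<in> Z" using sphere_subset x assms by blast
      then have "x = y \<or> dst x y = D" using \<delta>_le_dst[OF x] idx_le[of x y] assms by fastforce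
      then show ?thesis using y by (auto simp: idx_eq_0_iff)
    qed
  qed
qed (auto simp: refl_on_def)

theorem bipartite_half_or_antipodal:
  assumes "3 \<le> D" "\<not> is_cycle_graph (R 1)" "Z \<noteq> UNIV"
  shows "\<delta> = 2 \<and> bipartite_half (R 1) Z \<or> \<delta> = D \<and> equiv UNIV (Id \<union> R D)"
proof -
  have "\<delta> \<noteq> 1" using UNIV_if_\<delta>_eq_1 assms(3) by blast
  moreover have "\<not> (3 \<le> \<delta> \<and> \<delta> < D)"
    using valency_1_eq_2 valency_1_eq_2_imp_cycle_graph assms(2) by blast
  ultimately have "\<delta> = 2 \<or> \<delta> = D" using \<delta>_pos \<delta>_le by linarith
  then show ?thesis using bipartite_half_if_\<delta>_eq_2 antipodal_if_\<delta>_eq_D assms(1) by blast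
qed

end

context metric_association_scheme
begin

lemma eq_if_bipartite_half_subset:
  assumes half: "bipartite_half (R 1) Z" and "Z \<subseteq> Y"
    and independent: "\<And>u v. u \<in> Y \<Longrightarrow> v \<in> Y \<Longrightarrow> dst u v \<noteq> 1"
  shows "Z = Y"
proof
  show "Y \<subseteq> Z"
  proof
    fix u assume u: "u \<in> Y"
    obtain v where v: "dst u v = 1" using ex_idx[OF D_pos] by blast
    then have "v \<notin> Z" using independent[OF u] \<open>Z \<subseteq> Y\<close> by blast
    then show "u \<in> Z" using half v D_pos by (auto simp: bipartite_half_def in_R_iff)
  qed
qed fact

theorem code_closed_under_minimum_distance_cases:
  assumes D3: "3 \<le> D" and not_cycle: "\<not> is_cycle_graph (R 1)" and "Y \<noteq> UNIV"
    and attained: "x \<in> Y" "y \<in> Y" "x \<noteq> y" "dst x y = \<delta>"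
    and minimum: "\<And>y z. y \<in> Y \<Longrightarrow> z \<in> Y \<Longrightarrow> y \<noteq> z \<Longrightarrow> \<delta> \<le> dst y z"
    and closed: "\<And>x y. x \<in> Y \<Longrightarrow> y \<in> Y \<Longrightarrow> dst x y = \<delta> \<Longrightarrow> sphere x \<delta> \<subseteq> Y"
  shows "bipartite_half (R 1) Y \<or> equiv UNIV (Id \<union> R D) \<and> Y = (Id \<union> R D) `` {x}"
proof -
  define Z where "Z = {z \<in> Y. \<exists>w\<in>Y. dst z w = \<delta>}"
  have "Z \<subseteq> Y" by (auto simp: Z_def)
  then have "Z \<noteq> UNIV" using \<open>Y \<noteq> UNIV\<close> by blast
  interpret Z: sphere_closed_code D R Z \<delta>
  proof
    show "0 < \<delta>" "\<delta> \<le> D" using attained idx_le by (auto simp flip: idx_eq_0_iff)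
    show "Z \<noteq> {}" using attained by (auto simp: Z_def)
    show "sphere z \<delta> \<subseteq> Z" if "z \<in> Z" for z
      using that closed by (fastforce simp: Z_def idx_commute)
    show "\<delta> \<le> dst y z" if "y \<in> Z" "z \<in> Z" "y \<noteq> z" for y z
      using that \<open>Z \<subseteq> Y\<close> minimum by blast
  qed
  consider "\<delta> = 2" "bipartite_half (R 1) Z" | "\<delta> = D" "equiv UNIV (Id \<union> R D)"
    using Z.bipartite_half_or_antipodal[OF D3 not_cycle \<open>Z \<noteq> UNIV\<close>] by blast
  then show ?thesis
  proof cases
    case 1
    have "dst u v \<noteq> 1" if "u \<in> Y" "v \<in> Y" for u v
      using minimum[OF that] 1(1) by (cases "u = v") auto
    with 1(2) \<open>Z \<subseteq> Y\<close> show ?thesis using eq_if_bipartite_half_subset by metis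
  next
    case 2
    have "z \<in> insert x (sphere x D)" if "z \<in> Y" for z
      using minimum[OF attained(1) that] idx_le[of x z] 2(1) by (cases "x = z") auto
    moreover have "sphere x D \<subseteq> Y" using closed[OF attained(1,2,4)] 2(1) by simp
    ultimately have "Y = insert x (sphere x D)" using attained(1) by blast
    also have "\<dots> = (Id \<union> R D) `` {x}" by (auto simp: sphere_eq_Image)
    finally show ?thesis using 2(2) by simp
  qed
qed

lemma dst_neighbour_antipode:
  assumes antipodal: "equiv UNIV (Id \<union> R D)" and "2 \<le> D" and dst: "dst x y = 1" "dst x z = D"
  shows "dst z y = D - 1"
proof -
  have "dst z y \<noteq> D"
  proof
    assume "dst z y = D"
    then have "(x, z) \<in> Id \<union> R D" "(z, y) \<in> Id \<union> R D" using dst by (simp_all add: in_R_iff)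
    then have "(x, y) \<in> Id \<union> R D" using antipodal by (meson equivE transD)
    then show False using dst(1) \<open>2 \<le> D\<close> by (auto simp: in_R_iff)
  qed
  moreover have "D \<le> 1 + dst z y" using dst_triangle[of x z y] dst idx_commute[of z y] by simp
  ultimately show ?thesis using idx_le[of z y] by linarith
qed

end

subsection \<open>Terwilliger modules of metric and cometric schemes\<close>

context metric_association_scheme
begin

lemma intersection_number_1_eq_0:
  assumes "Suc j < k" "k \<le> D"
  shows "intersection_number 1 j k = 0"
proof -
  fix x :: 'x
  obtain y where y: "dst x y = k" using ex_idx[OF assms(2)] by blast
  have "dst y z \<noteq> j" if "dst x z = 1" for z
    using dst_triangle[of x y z] idx_commute[of y z] that y assms(1) by linarith
  then have "sphere x 1 \<inter> sphere y j = {}" by auto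
  with y show ?thesis by (simp add: sphere_Int_empty_iff)
qed

lemma intersection_number_1_Suc_nonzero:
  assumes "Suc j \<le> D"
  shows "intersection_number 1 j (Suc j) \<noteq> 0"
proof -
  fix x :: 'x
  obtain y where y: "dst x y = Suc j" using ex_idx[OF assms] by blast
  then obtain z where "dst x z = 1" "dst z y = j" using dst_intermediate[of x y 1 j] by auto
  then have "z \<in> sphere x 1 \<inter> sphere y j" by (simp add: idx_commute)
  then have "sphere x 1 \<inter> sphere y j \<noteq> {}" by blast
  with y show ?thesis by (simp add: sphere_Int_empty_iff)
qed

lemma mvec_adjacency_adj_R:
  assumes "Suc j \<le> D"
  shows "mvec (adj (R 1)) (mvec (adj (R j)) v) y =
    (\<Sum>k<Suc (Suc j). of_nat (intersection_number 1 j k) * mvec (adj (R k)) v y)"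
proof -
  let ?p = "\<lambda>k. of_nat (intersection_number 1 j k) :: complex"
  have "mvec (adj (R 1)) (mvec (adj (R j)) v) y = mvec (\<lambda>x y. \<Sum>k\<le>D. ?p k * adj (R k) x y) v y"
    unfolding mvec_mmult[symmetric] using assms by (subst mmult_adj_R) (simp_all add: sum_adj_R)
  also have "\<dots> = (\<Sum>k\<le>D. ?p k * mvec (adj (R k)) v y)" by (simp only: mvec_sum mvec_scale)
  also have "\<dots> = (\<Sum>k<Suc (Suc j). ?p k * mvec (adj (R k)) v y)"
    using assms
    by (intro sum.mono_neutral_right) (auto simp: intersection_number_1_eq_0[unfolded One_nat_def])
  finally show ?thesis .
qed

lemma adj_R_invariant_if_adjacency_invariant:
  assumes S: "csubspace S" and A: "\<And>w. w \<in> S \<Longrightarrow> mvec (adj (R 1)) w \<in> S"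
    and w: "w \<in> S" and "i \<le> D"
  shows "mvec (adj (R i)) w \<in> S"
  using \<open>i \<le> D\<close>
proof (induction i rule: less_induct)
  case (less i)
  show ?case
  proof (cases i)
    case 0
    have "adj (R 0) = diag_mat (\<lambda>_. 1)" by (simp add: adj_R diag_mat_def idx_eq_0_iff)
    with 0 w show ?thesis by (simp add: mvec_diag_mat)
  next
    case (Suc j)
    let ?p = "\<lambda>k. of_nat (intersection_number 1 j k) :: complex"
    let ?u = "mvec (adj (R 1)) (mvec (adj (R j)) w)"
    let ?v = "\<lambda>y. \<Sum>k<i. ?p k * mvec (adj (R k)) w y"
    have "?v \<in> S" using less by (intro csubspace_sum[OF S] csubspace_scale[OF S]) simp
    moreover have "?u \<in> S" using less Suc by (intro A) simp
    ultimately have "(\<lambda>y. 1 / ?p i * (?u y - ?v y)) \<in> S"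
      using csubspace_scale[OF S] csubspace_diff[OF S] by blast
    moreover have "1 / ?p i * (?u y - ?v y) = mvec (adj (R i)) w y" for y
    proof -
      have "?u y = ?v y + ?p i * mvec (adj (R i)) w y"
        using less.prems unfolding Suc by (subst mvec_adjacency_adj_R) simp_all
      then show ?thesis using less.prems Suc intersection_number_1_Suc_nonzero[of j] by simp
    qed
    ultimately show ?thesis by simp
  qed
qed

lemma bose_mesner_invariant_if_adjacency_invariant:
  assumes S: "csubspace S" and A: "\<And>w. w \<in> S \<Longrightarrow> mvec (adj (R 1)) w \<in> S"
    and B: "B \<in> M" and w: "w \<in> S"
  shows "mvec B w \<in> S"
proof -
  obtain c where "B = (\<lambda>x y. \<Sum>i\<le>D. c i * adj (R i) x y)" using B by (auto simp: bose_mesner_def)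
  then have "mvec B w = (\<lambda>y. \<Sum>i\<le>D. c i * mvec (adj (R i)) w y)" by (simp only: mvec_sum mvec_scale)
  also have "\<dots> \<in> S"
    by (intro csubspace_sum[OF S] csubspace_scale[OF S]
        adj_R_invariant_if_adjacency_invariant[OF S A w])
      auto
  finally show ?thesis .
qed

lemma cinner_mvec_adjacency: "cinner (mvec (adj (R 1)) u) v = cinner u (mvec (adj (R 1)) v)"
proof -
  have "cadjoint (adj (R 1)) = adj (R 1)"
    using D_pos
    by (simp add: bose_mesner_cadjoint adj_R_in_bose_mesner) (auto simp: adj_def fun_eq_iff)
  then show ?thesis by (simp add: cinner_mvec_cadjoint)
qed

lemma adjacency_tridiagonal:
  assumes "a + 1 < b \<or> b + 1 < a"
  shows "sphere_part x b (mvec (adj (R 1)) (sphere_part x a w)) = zvec"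
proof
  fix y
  have "adj (R 1) y z * sphere_part x a w z = 0" if "dst x y = b" for z
    using that assms dst_triangle[of x z y] dst_triangle[of x y z] D_pos idx_commute[of y z]
    by (auto simp: sphere_part_def adj_def in_R_iff)
  then have "mvec (adj (R 1)) (sphere_part x a w) y = 0" if "dst x y = b"
    using that unfolding mvec_def by (intro sum.neutral) blast
  then show "sphere_part x b (mvec (adj (R 1)) (sphere_part x a w)) y = zvec y"
    by (simp add: sphere_part_def zvec_def)
qed

end

lemma (in cometric_association_scheme) E_invariant_if_E1_invariant:
  assumes S: "csubspace S" and dual: "\<And>w. w \<in> S \<Longrightarrow> (\<lambda>y. E 1 x y * w y) \<in> S"
    and "j \<le> D" "w \<in> S"
  shows "(\<lambda>y. E j x y * w y) \<in> S"
proof -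
  obtain p where p: "\<And>x y. E j x y = poly p (E 1 x y)" using E_polynomial[OF \<open>j \<le> D\<close>] by metis
  have "(\<lambda>y. poly p (E 1 x y) * w y) \<in> S"
    using \<open>w \<in> S\<close>
  proof (induction p arbitrary: w)
    case 0
    then show ?case using csubspace_zvec[OF S] by (simp add: zvec_def)
  next
    case (pCons a p)
    have "(\<lambda>y. a * w y + poly p (E 1 x y) * (E 1 x y * w y)) \<in> S"
      by (intro csubspace_add[OF S] csubspace_scale[OF S] pCons.IH dual pCons.prems)
    then show ?case by (simp add: algebra_simps)
  qed
  then show ?thesis by (simp only: p)
qed

locale metric_cometric_association_scheme =
  metric_association_scheme D R + cometric_association_scheme D R E
  for D and R :: "nat \<Rightarrow> ('x::finite \<times> 'x) set" and E
begin

lemma tmodule_if_adjacency_E1_invariant: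
  assumes "csubspace S" "\<And>w. w \<in> S \<Longrightarrow> mvec (adj (R 1)) w \<in> S"
    and "\<And>w. w \<in> S \<Longrightarrow> (\<lambda>y. E 1 x y * w y) \<in> S"
  shows "tmodule D R E x S"
  using assms bose_mesner_invariant_if_adjacency_invariant E_invariant_if_E1_invariant
  by (intro tmoduleI) blast+

text \<open>\<open>split_annihilator x W i\<close> is the orthogonal complement of the sum of the \<open>E\<^sup>*\<^sub>a W\<close> with
  \<open>a \<ge> r + i\<close> and the \<open>E\<^sub>j W\<close> with \<open>j < r\<^sup>* + i\<close>. Up to scalar
  multiples, \<open>A\<close> maps it to the next one and \<open>A\<^sup>*\<close> to the previous one. Hence the vectors of \<open>W\<close>
  annihilated by all of them form a submodule, \<open>split_core x W\<close>; it contains \<open>E\<^sub>j W\<close> for \<open>j = r\<^sup>*\<close>.\<close>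

definition split_annihilator :: "'x \<Rightarrow> 'x cvec set \<Rightarrow> nat \<Rightarrow> 'x cvec set" where
  "split_annihilator x W i = {u. \<forall>w\<in>W.
    (\<forall>a\<ge>endpoint D R x W + i. cinner u (sphere_part x a w) = 0) \<and>
    (\<forall>j\<le>D. j < dual_endpoint D E W + i \<longrightarrow> cinner u (mvec (E j) w) = 0)}"

lemma split_annihilatorI:
  assumes "\<And>w a. w \<in> W \<Longrightarrow> endpoint D R x W + i \<le> a \<Longrightarrow> cinner u (sphere_part x a w) = 0"
    and "\<And>w j. w \<in> W \<Longrightarrow> j \<le> D \<Longrightarrow> j < dual_endpoint D E W + i \<Longrightarrow> cinner u (mvec (E j) w) = 0"
  shows "u \<in> split_annihilator x W i"
  using assms by (simp add: split_annihilator_def)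

lemma split_annihilatorD:
  assumes "u \<in> split_annihilator x W i" "w \<in> W"
  shows "endpoint D R x W + i \<le> a \<Longrightarrow> cinner u (sphere_part x a w) = 0"
    and "j \<le> D \<Longrightarrow> j < dual_endpoint D E W + i \<Longrightarrow> cinner u (mvec (E j) w) = 0"
  using assms by (simp_all add: split_annihilator_def)

lemma split_annihilator_0_subset_perp: "split_annihilator x W 0 \<subseteq> perp W"
proof
  fix u assume u: "u \<in> split_annihilator x W 0"
  show "u \<in> perp W"
  proof (rule perpI)
    fix w assume w: "w \<in> W"
    have "cinner u (sphere_part x a w) = 0" for a
      using split_annihilatorD(1)[OF u w, of a] endpoint_le[OF w, of x a]
      by (metis add_0_right cinner_zvec(2))
    then show "cinner u w = 0" by (subst cinner_eq_sum_sphere_part[of _ _ x]) simp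
  qed
qed

lemma split_annihilator_raise:
  assumes W: "tmodule D R E x W" and u: "u \<in> split_annihilator x W i"
  shows "\<exists>\<theta>. (\<lambda>y. mvec (adj (R 1)) u y - \<theta> * u y) \<in> split_annihilator x W (Suc i)"
proof -
  let ?A = "adj (R 1)" and ?r = "endpoint D R x W" and ?s = "dual_endpoint D E W"
  have "\<exists>\<theta>. mmult ?A (E j) = (\<lambda>x y. \<theta> * E j x y)" if "j \<le> D" for j
    using bose_mesner_eigenvalue[OF adj_R_in_bose_mesner[OF D_pos] that] by blast
  then obtain \<theta> where \<theta>: "\<And>j. j \<le> D \<Longrightarrow> mmult ?A (E j) = (\<lambda>x y. \<theta> j * E j x y)" by metis
  have "(\<lambda>y. mvec ?A u y - cnj (\<theta> (?s + i)) * u y) \<in> split_annihilator x W (Suc i)"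
  proof (rule split_annihilatorI)
    fix w a assume w: "w \<in> W" and a: "?r + Suc i \<le> a"
    let ?v = "mvec ?A (sphere_part x a w)"
    have v: "?v \<in> W"
      by (intro tmodule_bose_mesner[OF W] adj_R_in_bose_mesner D_pos tmodule_sphere_part[OF W w])
    have "cinner u (sphere_part x b ?v) = 0" for b
    proof (cases "?r + i \<le> b")
      case True
      then show ?thesis by (rule split_annihilatorD(1)[OF u v])
    next
      case False
      then show ?thesis using a by (subst adjacency_tridiagonal) auto
    qed
    then have "cinner u ?v = 0" by (subst cinner_eq_sum_sphere_part[of _ _ x]) simp
    moreover have "cinner u (sphere_part x a w) = 0" using split_annihilatorD(1)[OF u w] a by simp
    ultimately show "cinner (\<lambda>y. mvec ?A u y - cnj (\<theta> (?s + i)) * u y) (sphere_part x a w) = 0"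
      by (simp only: cinner_minus_scaled cinner_mvec_adjacency) simp
  next
    fix w j assume w: "w \<in> W" and j: "j \<le> D" "j < ?s + Suc i"
    have "mvec ?A (mvec (E j) w) = (\<lambda>y. \<theta> j * mvec (E j) w y)"
      by (simp only: mvec_mmult[symmetric] \<theta>[OF j(1)] mvec_scale)
    then have "cinner (\<lambda>y. mvec ?A u y - cnj (\<theta> (?s + i)) * u y) (mvec (E j) w)
        = (cnj (\<theta> j) - cnj (\<theta> (?s + i))) * cinner u (mvec (E j) w)"
      by (simp only: cinner_minus_scaled cinner_mvec_adjacency cinner_scale_right left_diff_distrib)
    also have "\<dots> = 0" using split_annihilatorD(2)[OF u w j(1)] j(2) by (cases "j = ?s + i") auto
    finally show "cinner (\<lambda>y. mvec ?A u y - cnj (\<theta> (?s + i)) * u y) (mvec (E j) w) = 0" .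
  qed
  then show ?thesis by blast
qed

lemma cinner_mult_E1: "cinner (\<lambda>y. E 1 x y * u y) v = cinner u (\<lambda>y. E 1 x y * v y)"
  using D_pos by (simp only: cinner_mult_left E_real)

lemma split_annihilator_lower:
  assumes W: "tmodule D R E x W" and u: "u \<in> split_annihilator x W (Suc i)"
  shows "\<exists>\<theta>. (\<lambda>y. E 1 x y * u y - \<theta> * u y) \<in> split_annihilator x W i"
proof -
  let ?r = "endpoint D R x W" and ?s = "dual_endpoint D E W"
  obtain e where e: "E 1 = (\<lambda>x y. e (dst x y))"
    by (rule bose_mesnerE[OF E_in_bose_mesner[OF D_pos]])
  have "(\<lambda>y. E 1 x y * u y - cnj (e (?r + i)) * u y) \<in> split_annihilator x W i"
  proof (rule split_annihilatorI)
    fix w a assume w: "w \<in> W" and a: "?r + i \<le> a"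
    have "(\<lambda>y. E 1 x y * sphere_part x a w y) = (\<lambda>y. e a * sphere_part x a w y)"
      unfolding e sphere_part_def by auto
    then have "cinner (\<lambda>y. E 1 x y * u y - cnj (e (?r + i)) * u y) (sphere_part x a w)
        = (cnj (e a) - cnj (e (?r + i))) * cinner u (sphere_part x a w)"
      by (simp only: cinner_minus_scaled cinner_mult_E1 cinner_scale_right left_diff_distrib)
    also have "\<dots> = 0" using split_annihilatorD(1)[OF u w, of a] a by (cases "a = ?r + i") auto
    finally show "cinner (\<lambda>y. E 1 x y * u y - cnj (e (?r + i)) * u y) (sphere_part x a w) = 0" .
  next
    fix w j assume w: "w \<in> W" and j: "j \<le> D" "j < ?s + i"
    let ?v = "\<lambda>y. E 1 x y * mvec (E j) w y"
    have v: "?v \<in> W"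
      by (intro tmodule_hadamard_row[OF W] tmodule_bose_mesner[OF W _ w] E_in_bose_mesner j D_pos)
    have "cinner u (mvec (E k) ?v) = 0" if k: "k \<le> D" for k
    proof (cases "k < ?s + Suc i")
      case True
      then show ?thesis by (rule split_annihilatorD(2)[OF u v k])
    next
      case False
      then show ?thesis using j k by (subst E_dual_tridiagonal) auto
    qed
    then have "cinner u ?v = 0" by (subst cinner_eq_sum_mvec_E) simp
    moreover have "cinner u (mvec (E j) w) = 0"
      using split_annihilatorD(2)[OF u w j(1)] j(2) by simp
    ultimately show "cinner (\<lambda>y. E 1 x y * u y - cnj (e (?r + i)) * u y) (mvec (E j) w) = 0"
      by (simp only: cinner_minus_scaled cinner_mult_E1) simp
  qed
  then show ?thesis by blast
qed

definition split_core :: "'x \<Rightarrow> 'x cvec set \<Rightarrow> 'x cvec set" where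
  "split_core x W = {w \<in> W. \<forall>i. \<forall>u\<in>split_annihilator x W i. cinner u w = 0}"

lemma split_core_subset: "split_core x W \<subseteq> W"
  by (auto simp: split_core_def)

lemma split_annihilator_subset_perp_split_core: "split_annihilator x W i \<subseteq> perp (split_core x W)"
  by (auto simp: split_core_def intro: perpI)

lemma in_split_coreI:
  assumes w: "w \<in> W" and "\<And>i u. u \<in> split_annihilator x W (Suc i) \<Longrightarrow> cinner u w = 0"
  shows "w \<in> split_core x W"
proof -
  have "cinner u w = 0" if "u \<in> split_annihilator x W i" for u i
    using that assms perpD[OF subsetD[OF split_annihilator_0_subset_perp]] by (cases i) auto
  with w show ?thesis by (simp add: split_core_def)
qed

lemma tmodule_split_core:
  assumes W: "tmodule D R E x W"
  shows "tmodule D R E x (split_core x W)"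
proof (rule tmodule_if_adjacency_E1_invariant)
  show "csubspace (split_core x W)"
    unfolding csubspace_def using tmodule_imp_csubspace[OF W]
    by (auto simp: split_core_def cinner_add_right cinner_scale_right
        csubspace_zvec csubspace_add csubspace_scale)
next
  fix w assume w: "w \<in> split_core x W"
  then have w_W: "w \<in> W" using split_core_subset by blast
  have orthogonal: "cinner u w = 0" if "u \<in> split_annihilator x W i" for u i
    using that w by (simp add: split_core_def)
  show "mvec (adj (R 1)) w \<in> split_core x W"
  proof (rule in_split_coreI)
    show "mvec (adj (R 1)) w \<in> W"
      by (intro tmodule_bose_mesner[OF W] adj_R_in_bose_mesner D_pos w_W)
    fix i u assume u: "u \<in> split_annihilator x W (Suc i)"
    obtain \<theta> where "(\<lambda>y. mvec (adj (R 1)) u y - \<theta> * u y) \<in> split_annihilator x W (Suc (Suc i))"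
      using split_annihilator_raise[OF W u] by blast
    from orthogonal[OF this] orthogonal[OF u] show "cinner u (mvec (adj (R 1)) w) = 0"
      by (simp only: cinner_minus_scaled cinner_mvec_adjacency) simp
  qed
  show "(\<lambda>y. E 1 x y * w y) \<in> split_core x W"
  proof (rule in_split_coreI)
    show "(\<lambda>y. E 1 x y * w y) \<in> W" by (intro tmodule_hadamard_row[OF W] E_in_bose_mesner D_pos w_W)
    fix i u assume u: "u \<in> split_annihilator x W (Suc i)"
    obtain \<theta> where "(\<lambda>y. E 1 x y * u y - \<theta> * u y) \<in> split_annihilator x W i"
      using split_annihilator_lower[OF W u] by blast
    from orthogonal[OF this] orthogonal[OF u] show "cinner u (\<lambda>y. E 1 x y * w y) = 0"
      by (simp only: cinner_minus_scaled cinner_mult_E1) simp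
  qed
qed

lemma mvec_E_dual_endpoint_in_split_core:
  assumes W: "tmodule D R E x W" and w: "w \<in> W" and le: "dual_endpoint D E W \<le> D"
  shows "mvec (E (dual_endpoint D E W)) w \<in> split_core x W"
proof (rule in_split_coreI)
  show "mvec (E (dual_endpoint D E W)) w \<in> W"
    by (intro tmodule_bose_mesner[OF W] E_in_bose_mesner le w)
  show "cinner u (mvec (E (dual_endpoint D E W)) w) = 0"
    if "u \<in> split_annihilator x W (Suc i)" for u i
    using that w le by (rule split_annihilatorD(2)) simp
qed

theorem split_annihilator_subset_perp_if_irreducible:
  assumes irreducible: "irreducible_tmodule D R E x W"
  shows "split_annihilator x W i \<subseteq> perp W"
proof -
  have W: "tmodule D R E x W" using irreducible by (simp add: irreducible_tmodule_def)
  obtain v where "v \<in> W" "v \<noteq> zvec" by (rule irreducible_tmodule_nonzero[OF irreducible])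
  from dual_endpoint_attained[OF this] have "split_core x W \<noteq> {zvec}"
    using mvec_E_dual_endpoint_in_split_core[OF W] by blast
  then have "split_core x W = W"
    using irreducible tmodule_split_core[OF W] split_core_subset
    unfolding irreducible_tmodule_def by blast
  then show ?thesis using split_annihilator_subset_perp_split_core[of x W i] by simp
qed

subsection \<open>Relative designs supported on a sphere\<close>

lemma sphere_part_design_in_perp:
  assumes irreducible: "irreducible_tmodule D R E x W" and "W \<subseteq> perp (primary x)"
    and design: "relative_design E t x (sphere_part x \<delta> v)" and le: "\<delta> \<le> t" "t \<le> D"
    and endpoints: "endpoint D R x W \<le> \<delta> \<Longrightarrow> dual_endpoint D E W \<le> endpoint D R x W"
  shows "sphere_part x \<delta> v \<in> perp W"
proof (cases "endpoint D R x W \<le> \<delta>")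
  case True
  have "sphere_part x \<delta> v \<in> split_annihilator x W (Suc \<delta> - endpoint D R x W)"
  proof (rule split_annihilatorI)
    fix w a assume "endpoint D R x W + (Suc \<delta> - endpoint D R x W) \<le> a"
    then show "cinner (sphere_part x \<delta> v) (sphere_part x a w) = 0"
      using True by (simp add: cinner_sphere_part_commute sphere_part_sphere_part)
  next
    fix w j assume "w \<in> W" "j < dual_endpoint D E W + (Suc \<delta> - endpoint D R x W)"
    then show "cinner (sphere_part x \<delta> v) (mvec (E j) w) = 0"
      using endpoints[OF True] True le assms(2)
      by (intro cinner_relative_design_mvec_E[OF design]) auto
  qed
  then show ?thesis using split_annihilator_subset_perp_if_irreducible[OF irreducible] by blast
next
  case False
  then have "sphere_part x \<delta> w = zvec" if "w \<in> W" for w using endpoint_le[OF that] by blast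
  then show ?thesis by (intro perpI) (simp add: cinner_sphere_part_commute)
qed

lemma sphere_part_design_in_primary:
  assumes design: "relative_design E t x (sphere_part x \<delta> v)" and le: "\<delta> \<le> t" "t \<le> D"
    and endpoints: "\<And>W. irreducible_tmodule D R E x W \<Longrightarrow> 1 \<le> endpoint D R x W \<Longrightarrow>
      endpoint D R x W \<le> \<delta> \<Longrightarrow> dual_endpoint D E W \<le> endpoint D R x W"
  shows "sphere_part x \<delta> v \<in> primary x"
proof (rule in_primary_if_orthogonal_to_irreducibles)
  fix W assume W: "irreducible_tmodule D R E x W" "W \<subseteq> perp (primary x)"
  obtain w where "w \<in> W" "w \<noteq> zvec" by (rule irreducible_tmodule_nonzero[OF W(1)])
  then have "1 \<le> endpoint D R x W" by (rule endpoint_pos_if_perp_primary[OF W(2)])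
  with endpoints[OF W(1)] show "sphere_part x \<delta> v \<in> perp W"
    by (intro sphere_part_design_in_perp[OF W design le]) blast
qed

lemma sphere_subset_design:
  assumes "relative_design E t x (sphere_part x \<delta> (chi Y))" "\<delta> \<le> t" "t \<le> D"
    and "\<And>W. irreducible_tmodule D R E x W \<Longrightarrow> 1 \<le> endpoint D R x W \<Longrightarrow>
      endpoint D R x W \<le> \<delta> \<Longrightarrow> dual_endpoint D E W \<le> endpoint D R x W"
    and y: "y \<in> Y" "dst x y = \<delta>"
  shows "sphere x \<delta> \<subseteq> Y"
proof
  fix z assume z: "z \<in> sphere x \<delta>"
  have "sphere_part x \<delta> (chi Y) \<in> primary x"
    using assms(1-4) by (rule sphere_part_design_in_primary)
  then obtain f where "sphere_part x \<delta> (chi Y) = (\<lambda>y. f (dst x y))" by (rule primaryE)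
  then have "sphere_part x \<delta> (chi Y) z = sphere_part x \<delta> (chi Y) y" using y z by simp
  then show "z \<in> Y" using y z by (simp add: sphere_part_def chi_def split: if_splits)
qed

end

subsection \<open>Antipodal schemes\<close>

lemma quadratic_invariant_at_negative_multiples:
  fixes \<alpha> \<beta> \<gamma> k a b :: "'a::idom"
  assumes "\<alpha> \<noteq> 0" "k + 1 \<noteq> 0" "a \<noteq> 0" "b \<noteq> 0" "a \<noteq> b"
    and q: "\<And>t. q t = \<gamma> + \<beta> * t + \<alpha> * t\<^sup>2"
    and values_eq: "q (- k * a) = q a" "q (- k * b) = q b"
  shows "k = 1"
proof -
  have slope: "\<alpha> * (k - 1) * c = \<beta>" if "q (- k * c) = q c" "c \<noteq> 0" for c
  proof -
    have "(k + 1) * c * (\<alpha> * (k - 1) * c - \<beta>) = q (- k * c) - q c"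
      by (simp add: q algebra_simps power2_eq_square)
    with that assms(2) show ?thesis by simp
  qed
  have "\<alpha> * (k - 1) * a = \<alpha> * (k - 1) * b" using slope values_eq assms(3,4) by metis
  then show ?thesis using assms(1,5) by simp
qed

lemma quadratic_equivariant_at_negative_multiples:
  fixes \<alpha> \<beta> \<gamma> k a b :: "'a::idom"
  assumes "\<alpha> \<noteq> 0" "k + 1 \<noteq> 0" "k \<noteq> 0" "a \<noteq> b"
    and q: "\<And>t. q t = \<gamma> + \<beta> * t + \<alpha> * t\<^sup>2"
    and values_eq: "q (- k * a) = - k * q a" "q (- k * b) = - k * q b"
  shows "a = - b"
proof -
  have square: "\<alpha> * k * c\<^sup>2 = - \<gamma>" if "q (- k * c) = - k * q c" for c
  proof -
    have "(k + 1) * (\<alpha> * k * c\<^sup>2 + \<gamma>) = q (- k * c) + k * q c"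
      by (simp add: q algebra_simps power2_eq_square)
    with that assms(2) show ?thesis by (simp add: eq_neg_iff_add_eq_0)
  qed
  have "\<alpha> * k * a\<^sup>2 = \<alpha> * k * b\<^sup>2" using square values_eq by metis
  then show ?thesis using assms(1,3,4) by (simp add: power2_eq_iff)
qed

lemma (in association_scheme_idempotents) E_constant_or_zero_sum_on_fibres:
  assumes equiv: "equiv UNIV (Id \<union> R i)" and i: "0 < i" "i \<le> D" and j: "j \<le> D"
  shows "(\<forall>u v w. idx u v = i \<longrightarrow> E j u w = E j v w)
    \<or> (\<forall>u w. E j u w = - (\<Sum>z\<in>sphere u i. E j z w))"
proof -
  let ?S = "Id \<union> R i"
  have "adj ?S = (\<lambda>x y. if idx x y = 0 \<or> idx x y = i then 1 else 0)"
    using i by (auto simp: adj_def in_R_iff idx_eq_0_iff fun_eq_iff)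
  then have "adj ?S \<in> M" by (simp only: bose_mesnerI[of "\<lambda>k. if k = 0 \<or> k = i then 1 else 0"])
  then obtain \<theta> where \<theta>: "mmult (adj ?S) (E j) = (\<lambda>x y. \<theta> * E j x y)"
    using bose_mesner_eigenvalue j by blast
  have fibre_sum: "(\<Sum>z\<in>?S `` {u}. E j z w) = \<theta> * E j u w" for u w
    using fun_cong[OF fun_cong[OF \<theta>], of u w] by (simp only: mmult_adj_left)
  show ?thesis
  proof (cases "\<theta> = 0")
    case True
    have "?S `` {u} = insert u (sphere u i)" for u using i by (auto simp: sphere_eq_Image)
    with fibre_sum True i have "E j u w + (\<Sum>z\<in>sphere u i. E j z w) = 0" for u w by simp
    then show ?thesis by (simp add: eq_neg_iff_add_eq_0)
  next
    case False
    have "E j u w = E j v w" if "idx u v = i" for u v w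
    proof -
      have "?S `` {u} = ?S `` {v}"
        using that i by (intro equiv_class_eq[OF equiv]) (simp add: in_R_iff)
      then have "\<theta> * E j u w = \<theta> * E j v w" by (metis fibre_sum)
      with False show ?thesis by simp
    qed
    then show ?thesis by blast
  qed
qed

context metric_cometric_association_scheme
begin

lemma E1_adjacent_ne_uminus_diag:
  assumes "2 \<le> D" "dst x y = 1"
  shows "E 1 x y \<noteq> - E 1 x x"
proof
  assume eq: "E 1 x y = - E 1 x x"
  have opposite_rows: "E 1 v w = - E 1 u w" if "dst u v = 1" for u v w
  proof -
    have E1_cong: "E 1 p q = E 1 p' q'" if "dst p q = dst p' q'" for p q p' q'
      using bose_mesner_cong[OF E_in_bose_mesner[OF D_pos] that] .
    have rows: "cinner (E 1 p) (E 1 q) = E 1 p q" for p q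
      using cinner_E_rows[OF D_pos D_pos] by simp
    have "cinner (\<lambda>z. E 1 u z + E 1 v z) (\<lambda>z. E 1 u z + E 1 v z)
      = E 1 u u + E 1 u v + (E 1 v u + E 1 v v)"
      by (simp only: cinner_add_left cinner_add_right rows)
    also have "\<dots> = 0"
      using E1_cong[of u u x x] E1_cong[of v v x x] E1_cong[of u v x y] E1_cong[of v u x y]
        that assms(2) eq idx_commute[of u v] by simp
    finally have "(\<lambda>z. E 1 u z + E 1 v z) = zvec" by (simp add: cinner_self_eq_0_iff)
    then show ?thesis by (metis add_eq_0_iff zvec_def)
  qed
  obtain w where w: "dst x w = 2" using ex_idx[OF assms(1)] by blast
  then obtain m where m: "dst x m = 1" "dst m w = 1" using dst_intermediate[of x w 1 1] by auto
  have "E 1 w x = E 1 x x" using opposite_rows[OF m(1), of x] opposite_rows[OF m(2), of x] by simp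
  then have "dst w x = dst x x" by (rule E1_inj)
  then show False using w by (simp add: idx_commute)
qed

lemma antipodal_E_values:
  assumes antipodal: "equiv UNIV (Id \<union> R D)" and D2: "2 \<le> D" and j: "j \<le> D"
    and x: "dst x x' = D" "dst x y = 1"
  shows "E j x x = E j x' x \<and> E j x y = E j x' y
    \<or> E j x x = - of_nat (valency D) * E j x' x \<and> E j x y = - of_nat (valency D) * E j x' y"
proof -
  have sum_sphere: "(\<Sum>z\<in>sphere x D. E j z w) = of_nat (valency D) * E j x' w"
    if "\<And>z. dst x z = D \<Longrightarrow> dst z w = dst x' w" for w
  proof -
    have "(\<Sum>z\<in>sphere x D. E j z w) = (\<Sum>z\<in>sphere x D. E j x' w)"
      using that by (intro sum.cong refl bose_mesner_cong[OF E_in_bose_mesner[OF j]]) simp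
    then show ?thesis by (simp add: card_sphere)
  qed
  have sum_x: "(\<Sum>z\<in>sphere x D. E j z x) = of_nat (valency D) * E j x' x"
    using x by (intro sum_sphere) (simp add: idx_commute)
  have sum_y: "(\<Sum>z\<in>sphere x D. E j z y) = of_nat (valency D) * E j x' y"
    by (intro sum_sphere) (simp add: x dst_neighbour_antipode[OF antipodal D2 x(2)])
  have "0 < D" using D_pos by simp
  from E_constant_or_zero_sum_on_fibres[OF antipodal this order_refl j] show ?thesis
  proof
    assume "\<forall>u v w. dst u v = D \<longrightarrow> E j u w = E j v w"
    then show ?thesis using x(1) by blast
  next
    assume "\<forall>u w. E j u w = - (\<Sum>z\<in>sphere u D. E j z w)"
    then have "E j x w = - (\<Sum>z\<in>sphere x D. E j z w)" for w by blast
    from this[of x] this[of y] show ?thesis unfolding sum_x sum_y by simp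
  qed
qed

lemma antipodal_E1_values:
  assumes "equiv UNIV (Id \<union> R D)" "2 \<le> D" and x: "dst x x' = D" "dst x y = 1"
  shows "E 1 x x = - of_nat (valency D) * E 1 x' x"
    and "E 1 x y = - of_nat (valency D) * E 1 x' y"
proof -
  have "E 1 x x \<noteq> E 1 x' x" using E1_inj[of x x x' x] x \<open>2 \<le> D\<close> by (auto simp: idx_commute)
  then show "E 1 x x = - of_nat (valency D) * E 1 x' x" "E 1 x y = - of_nat (valency D) * E 1 x' y"
    using antipodal_E_values[OF assms(1,2) D_pos x] by blast+
qed

lemma E2_quadratic:
  assumes "2 \<le> D"
  obtains \<gamma> \<beta> \<alpha> where "\<And>x y. E 2 x y = \<gamma> + \<beta> * E 1 x y + \<alpha> * (E 1 x y)\<^sup>2" "\<alpha> \<noteq> 0"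
proof -
  obtain p where p: "degree p = 2" "\<And>x y. E 2 x y = poly p (E 1 x y)"
    using E_polynomial[OF assms] by metis
  have "poly p t = coeff p 0 + coeff p 1 * t + coeff p 2 * t\<^sup>2" for t
    by (simp add: poly_altdef p(1) numeral_2_eq_2)
  then have "E 2 x y = coeff p 0 + coeff p 1 * E 1 x y + coeff p 2 * (E 1 x y)\<^sup>2" for x y
    by (simp only: p(2))
  moreover have "coeff p 2 \<noteq> 0" using p(1) by (metis leading_coeff_0_iff degree_0 zero_neq_numeral)
  ultimately show ?thesis using that by blast
qed

lemma antipodal_valency_eq_1:
  assumes antipodal: "equiv UNIV (Id \<union> R D)" and D3: "3 \<le> D"
  shows "valency D = 1"
proof -
  have D2: "2 \<le> D" using D3 by simp
  fix x :: 'x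
  obtain y where y: "dst x y = 1" using ex_idx[OF D_pos] by blast
  obtain x' where x': "dst x x' = D" using ex_idx[of D x] by blast
  define k :: complex where "k = of_nat (valency D)"
  have "valency D \<noteq> 0" using x' by (auto simp flip: card_sphere[of x])
  then have k: "k \<noteq> 0" "k + 1 \<noteq> 0"
    by (simp_all add: k_def of_nat_Suc[symmetric] add.commute del: of_nat_Suc)
  define a b where "a = E 1 x' x" and "b = E 1 x' y"
  have E1: "E 1 x x = - k * a" "E 1 x y = - k * b"
    using antipodal_E1_values[OF antipodal D2 x' y] by (simp_all add: a_def b_def k_def)
  have "a \<noteq> b" using E1_inj[of x x x y] y E1 by auto
  have "a \<noteq> 0" using E_diag_nonzero[OF D_pos, of x] E1 by auto
  have "b \<noteq> 0"
    using E1_inj[of x y x' y] E1 y dst_neighbour_antipode[OF antipodal D2 y x'] D3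
    by (auto simp: b_def)
  obtain \<gamma> \<beta> \<alpha> where quadratic: "\<And>x y. E 2 x y = \<gamma> + \<beta> * E 1 x y + \<alpha> * (E 1 x y)\<^sup>2"
    and "\<alpha> \<noteq> 0"
    by (rule E2_quadratic[OF D2]) (rule that)
  define q where "q t = \<gamma> + \<beta> * t + \<alpha> * t\<^sup>2" for t
  have E2: "E 2 x y = q (E 1 x y)" for x y by (simp add: q_def quadratic)
  consider "q (- k * a) = q a" "q (- k * b) = q b"
    | "q (- k * a) = - k * q a" "q (- k * b) = - k * q b"
    using antipodal_E_values[OF antipodal D2 D2 x' y] unfolding E2 E1
    by (auto simp: a_def b_def k_def)
  then show ?thesis
  proof cases
    case 1
    with \<open>\<alpha> \<noteq> 0\<close> k(2) \<open>a \<noteq> 0\<close> \<open>b \<noteq> 0\<close> \<open>a \<noteq> b\<close> q_def have "k = 1"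
      by (rule quadratic_invariant_at_negative_multiples)
    then show ?thesis by (simp add: k_def)
  next
    case 2
    with \<open>\<alpha> \<noteq> 0\<close> k(2,1) \<open>a \<noteq> b\<close> q_def have "a = - b"
      by (rule quadratic_equivariant_at_negative_multiples)
    then show ?thesis using E1_adjacent_ne_uminus_diag[OF D2 y] E1 by simp
  qed
qed

theorem antipodal_imp_double_cover:
  assumes antipodal: "equiv UNIV (Id \<union> R D)" and "3 \<le> D"
  shows "antipodal_double_cover D R"
proof -
  have "card {y. (x, y) \<in> Id \<union> R D} = 2" for x
  proof -
    have "{y. (x, y) \<in> Id \<union> R D} = insert x (sphere x D)" by (auto simp: in_R_iff)
    moreover have "x \<notin> sphere x D" using \<open>3 \<le> D\<close> by simp
    ultimately show ?thesis
      using antipodal_valency_eq_1[OF assms] by (simp add: card_sphere)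
  qed
  with antipodal show ?thesis by (simp add: antipodal_double_cover_def)
qed

end

lemma antipodal_double_cover_pair:
  assumes "antipodal_double_cover D R" "x \<noteq> y" "y \<in> (Id \<union> R D) `` {x}"
  shows "(Id \<union> R D) `` {x} = {x, y} \<and> (x, y) \<in> R D"
proof -
  have "card ((Id \<union> R D) `` {x}) = card {x, y}"
    using assms(1,2) by (simp add: antipodal_double_cover_def Image_singleton)
  moreover have "{x, y} \<subseteq> (Id \<union> R D) `` {x}" using assms(3) by auto
  ultimately have "(Id \<union> R D) `` {x} = {x, y}" by (metis card_subset_eq finite)
  moreover have "(x, y) \<in> R D" using assms(2,3) by auto
  ultimately show ?thesis ..
qed

theorem theorem6p8:
  fixes R :: "nat \<Rightarrow> ('x::finite \<times> 'x) set" and E :: "nat \<Rightarrow> 'x cmat"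
    and D t :: nat and Y :: "'x set"
  assumes scheme: "assoc_scheme D R" and D3: "D \<ge> 3"
    and metric: "metric_scheme D R"
    and idem: "primitive_idempotents D R E"
    and comet: "cometric D E"
    and not_cycle: "\<not> is_cycle_graph (R 1)"
    and Y_size: "1 < card Y" "card Y < card (UNIV :: 'x set)"
    and t_le: "t \<le> D"
    and design: "\<forall>k\<le>D. \<forall>x\<in>Y. relative_design E t x (mvec (estar R k x) (chi Y))"
    and modules: "\<forall>x\<in>Y. \<forall>W. irreducible_tmodule D R E x W \<and> 1 \<le> endpoint D R x W
                    \<and> endpoint D R x W \<le> min_dist D R Y
                    \<longrightarrow> dual_endpoint D E W \<le> endpoint D R x W"
  shows "bipartite_half (R 1) Y
         \<or> (antipodal_double_cover D R \<and> (\<exists>x y. Y = {x, y} \<and> (x, y) \<in> R D))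
         \<or> min_dist D R Y \<ge> t + 1"
proof (cases "min_dist D R Y \<le> t")
  case True
  interpret metric_cometric_association_scheme D R E
    by unfold_locales (fact scheme metric idem comet)+
  obtain x y where xy: "x \<in> Y" "y \<in> Y" "x \<noteq> y" "idx x y = min_dist D R Y"
    using min_dist_attained[OF Y_size(1)] by blast
  have closed: "sphere u (min_dist D R Y) \<subseteq> Y" if "u \<in> Y" "v \<in> Y" "idx u v = min_dist D R Y" for u v
  proof (rule sphere_subset_design[OF _ True t_le _ that(2,3)])
    show "relative_design E t u (sphere_part u (min_dist D R Y) (chi Y))"
      using design that(1) True t_le by (simp flip: mvec_estar)
  qed (use modules that(1) in blast)
  have "Y \<noteq> UNIV" using Y_size(2) by blast
  then have "bipartite_half (R 1) Y \<or> equiv UNIV (Id \<union> R D) \<and> Y = (Id \<union> R D) `` {x}"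
    using xy min_dist_le closed
    by (rule code_closed_under_minimum_distance_cases[OF D3 not_cycle])
  then consider "bipartite_half (R 1) Y" | "equiv UNIV (Id \<union> R D)" "Y = (Id \<union> R D) `` {x}" by blast
  then show ?thesis
  proof cases
    case 2
    from 2(1) D3 have cover: "antipodal_double_cover D R" by (rule antipodal_imp_double_cover)
    then have "Y = {x, y} \<and> (x, y) \<in> R D"
      using antipodal_double_cover_pair xy(2,3) unfolding 2(2) by metis
    with cover show ?thesis by blast
  qed blast
qed simp

end
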